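(* Let $Y$ and $X$ be metric surfaces and let $f\colon Y\to X$ be weakly quasiconformal. If a weakly monotone function $u\colon X\to\mathbb{R}$ has a locally $2$-integrable upper gradient, then $v=u\circ f$ is also weakly monotone and has a locally $2$-integrable upper gradient.
   Context: A metric surface is a metric space in which every point has an open neighbourhood homeomorphic to an open subset of the plane, and whose Hausdorff 2-measure $\mathcal{H}^2$ (normalized to agree with Lebesgue measure on $\mathbb{R}^2$) is finite on compact subsets. A function $u\colon X\to\mathbb{R}$ is weakly monotone if for every open $V$ compactly contained in $X$ (i.e. $\overline V$ is compact in $X$), $\sup_V u\leq\sup_{\partial V}u<\infty$ and $\inf_V u\geq\inf_{\partial V}u>-\infty$. An upper gradient of $u\colon X\to\mathbb{R}$ is a Borel function $\rho\colon X\to[0,\infty]$ such that $|u(x)-u(y)|\leq\int_\gamma\rho\,ds$ for all $x,y\in X$ and all rectifiable paths $\gamma$ joining $x$ and $y$ in $X$. It is locally $2$-integrable if $\int_C\rho^2\,d\mathcal{H}^2<\infty$ for every compact $C\subset X$. For a path (continuous map from a compact interval) $\gamma$ in $X$ and Borel $\rho\colon X\to[0,\infty]$, $\int_\gamma\rho\,ds:=\int_X\#(\gamma^{-1}(x))\rho(x)\,d\mathcal{H}^1(x)$, which for rectifiable $\gamma$ is the usual arclength integral. For a family $\Gamma$ of paths in $X$, the $2$-modulus is $\operatorname{mod}\Gamma=\inf\int_X\rho^2\,d\mathcal{H}^2$, the infimum over Borel $\rho\colon X\to[0,\infty]$ with $\int_\gamma\rho\,ds\geq 1$ for every $\gamma\in\Gamma$.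 A map $f\colon Y\to X$ is weakly $K$-quasiconformal ($K\geq1$) if $f$ is a uniform limit of homeomorphisms $Y\to X$ and $\operatorname{mod}\Gamma\leq K\operatorname{mod}f\Gamma$ for every path family $\Gamma$ in $Y$, where $f\Gamma=\{f\circ\gamma:\gamma\in\Gamma\}$. It is weakly quasiconformal if it is weakly $K$-quasiconformal for some $K\geq 1$. *)

theory Defs
  imports "HOL-Analysis.Analysis"
begin

section \<open>Hausdorff measure\<close>

text \<open>
  The weight of a set is the Lebesgue measure of an \<open>m\<close>-dimensional ball of the same diameter, so
  that \<open>hausdorff_measure m\<close> agrees with Lebesgue measure on \<open>m\<close>-dimensional Euclidean space: the
  factor is \<open>1\<close> for \<open>m = 1\<close> and \<open>pi / 4\<close> for \<open>m = 2\<close>.  Only \<open>m \<ge> 1\<close> is meaningful, because the empty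
  set would get weight \<open>1\<close> for \<open>m = 0\<close>.
\<close>

definition hausdorff_weight :: "nat \<Rightarrow> 'a::metric_space set \<Rightarrow> ennreal" where
  "hausdorff_weight m E = ennreal (unit_ball_vol (real m) * (diameter E / 2) ^ m)"

text \<open>
  Boundedness of the covering sets is required separately because \<^const>\<open>diameter\<close> is real-valued
  and unspecified on unbounded sets.
\<close>

definition hausdorff_pre :: "nat \<Rightarrow> real \<Rightarrow> 'a::metric_space set \<Rightarrow> ennreal" where
  "hausdorff_pre m \<delta> A =
     (INF E \<in> {E :: nat \<Rightarrow> 'a set. A \<subseteq> (\<Union>i. E i) \<and> (\<forall>i. bounded (E i) \<and> diameter (E i) \<le> \<delta>)}.
        \<Sum>i. hausdorff_weight m (E i))"

definition hausdorff_outer :: "nat \<Rightarrow> 'a::metric_space set \<Rightarrow> ennreal" where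
  "hausdorff_outer m A = (SUP \<delta>\<in>{0<..}. hausdorff_pre m \<delta> A)"

definition hausdorff_measure :: "nat \<Rightarrow> 'a::metric_space measure" where
  "hausdorff_measure m = measure_of UNIV (sets borel) (hausdorff_outer m)"

lemma space_hausdorff_measure [simp]: "space (hausdorff_measure m) = UNIV"
  by (simp add: hausdorff_measure_def)

lemma sets_hausdorff_measure [simp, measurable_cong]: "sets (hausdorff_measure m) = sets borel"
  unfolding hausdorff_measure_def using sets.sigma_sets_eq[of borel] by simp

subsection \<open>The Hausdorff measure is given by the Hausdorff outer measure\<close>

text \<open>
  The constant \<^const>\<open>measure_of\<close> returns the null measure unless the given set function is
  countably additive, so this is what makes \<open>hausdorff_measure\<close> meaningful.
\<close>

lemma hausdorff_weight_empty: "m > 0 \<Longrightarrow> hausdorff_weight m {} = 0"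
  by (simp add: hausdorff_weight_def)

lemma hausdorff_pre_le:
  assumes "A \<subseteq> (\<Union>i. E i)" "\<And>i. bounded (E i)" "\<And>i. diameter (E i) \<le> \<delta>"
  shows "hausdorff_pre m \<delta> A \<le> (\<Sum>i. hausdorff_weight m (E i))"
  unfolding hausdorff_pre_def by (rule INF_lower) (use assms in auto)

lemma hausdorff_pre_close:
  assumes "hausdorff_pre m \<delta> A < e"
  shows "\<exists>E. A \<subseteq> (\<Union>i. E i) \<and> (\<forall>i. bounded (E i) \<and> diameter (E i) \<le> \<delta>) \<and>
    (\<Sum>i. hausdorff_weight m (E i)) < e"
  using assms unfolding hausdorff_pre_def INF_less_iff by auto

lemma hausdorff_pre_mono: "A \<subseteq> B \<Longrightarrow> hausdorff_pre m \<delta> A \<le> hausdorff_pre m \<delta> B"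
  unfolding hausdorff_pre_def by (rule INF_superset_mono) auto

lemma hausdorff_pre_antimono: "\<delta> \<le> \<epsilon> \<Longrightarrow> hausdorff_pre m \<epsilon> A \<le> hausdorff_pre m \<delta> A"
  unfolding hausdorff_pre_def by (rule INF_superset_mono) (auto intro: order_trans)

lemma hausdorff_outer_mono: "A \<subseteq> B \<Longrightarrow> hausdorff_outer m A \<le> hausdorff_outer m B"
  unfolding hausdorff_outer_def by (intro SUP_mono') (rule hausdorff_pre_mono)

lemma hausdorff_pre_le_outer: "\<delta> > 0 \<Longrightarrow> hausdorff_pre m \<delta> A \<le> hausdorff_outer m A"
  unfolding hausdorff_outer_def by (rule SUP_upper) simp

lemma hausdorff_outer_empty:
  assumes "m > 0"
  shows "hausdorff_outer m ({} :: 'a::metric_space set) = 0"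
proof -
  have "hausdorff_pre m \<delta> ({} :: 'a set) \<le> 0" if "\<delta> > 0" for \<delta>
    using hausdorff_pre_le[of "{}" "\<lambda>_. {} :: 'a set" \<delta> m] that
      hausdorff_weight_empty[OF assms, where 'a='a] by simp
  then have "hausdorff_outer m ({} :: 'a set) \<le> 0"
    unfolding hausdorff_outer_def by (intro SUP_least) auto
  then show ?thesis by simp
qed

lemma hausdorff_pre_countably_subadditive:
  fixes A :: "nat \<Rightarrow> 'a::metric_space set"
  shows "hausdorff_pre m \<delta> (\<Union>i. A i) \<le> (\<Sum>n. hausdorff_pre m \<delta> (A n))"
proof (rule ennreal_le_epsilon)
  let ?O = "hausdorff_pre m \<delta> :: 'a set \<Rightarrow> ennreal"
  fix e :: real assume e: "0 < e" and fin: "(\<Sum>n. ?O (A n)) < top"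
  have *: "?O (A n) < ?O (A n) + e * (1/2) ^ Suc n" for n
    using e fin by (auto simp add: less_top dest!: ennreal_suminf_lessD)
  have "\<exists>E. A n \<subseteq> (\<Union>i. E i) \<and> (\<forall>i. bounded (E i) \<and> diameter (E i) \<le> \<delta>) \<and>
      (\<Sum>i. hausdorff_weight m (E i)) < ?O (A n) + e * (1/2) ^ Suc n" for n
    by (rule hausdorff_pre_close[OF *])
  then obtain B where B: "\<And>n. A n \<subseteq> (\<Union>i. B n i)"
      "\<And>n i. bounded (B n i)" "\<And>n i. diameter (B n i) \<le> \<delta>"
      "\<And>n. (\<Sum>i. hausdorff_weight m (B n i)) < ?O (A n) + e * (1/2) ^ Suc n"
    by metis
  define C where "C = case_prod B \<circ> prod_decode"
  have "(\<Union>i. A i) \<subseteq> (\<Union>i. C i)"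
    using B(1) by (auto simp add: C_def subset_eq) (metis prod.case prod_encode_inverse)
  then have "?O (\<Union>i. A i) \<le> (\<Sum>i. hausdorff_weight m (C i))"
    by (rule hausdorff_pre_le) (auto simp: C_def split_def B)
  also have "\<dots> = (\<Sum>n. \<Sum>i. hausdorff_weight m (B n i))"
    unfolding C_def comp_def
    using suminf_ennreal_2dimen[of "\<lambda>n. \<Sum>i. hausdorff_weight m (B n i)"
        "\<lambda>p. hausdorff_weight m (case_prod B p)"] by simp
  also have "\<dots> \<le> (\<Sum>n. ?O (A n) + e * (1/2) ^ Suc n)"
    by (intro suminf_le allI less_imp_le B) auto
  also have "\<dots> = (\<Sum>n. ?O (A n)) + (\<Sum>n. ennreal e * ennreal ((1/2) ^ Suc n))"
    using e by (subst suminf_add[symmetric])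
      (auto simp del: ennreal_suminf_cmult simp add: ennreal_mult[symmetric])
  also have "\<dots> = (\<Sum>n. ?O (A n)) + e"
    unfolding ennreal_suminf_cmult
    by (subst suminf_ennreal_eq[OF zero_le_power power_half_series]) auto
  finally show "?O (\<Union>i. A i) \<le> (\<Sum>n. ?O (A n)) + e" .
qed

lemma hausdorff_outer_countably_subadditive:
  "hausdorff_outer m (\<Union>i. A i) \<le> (\<Sum>n. hausdorff_outer m (A n))"
proof -
  have "hausdorff_pre m \<delta> (\<Union>i. A i) \<le> (\<Sum>n. hausdorff_outer m (A n))" if "\<delta> > 0" for \<delta>
    using hausdorff_pre_countably_subadditive[of m \<delta> A]
      suminf_le[of "\<lambda>n. hausdorff_pre m \<delta> (A n)" "\<lambda>n. hausdorff_outer m (A n)"]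
      hausdorff_pre_le_outer[OF that, of m] by (auto intro: order_trans)
  then show ?thesis
    unfolding hausdorff_outer_def[of m "\<Union>i. A i"] by (intro SUP_least) auto
qed

lemma hausdorff_outer_space:
  assumes "m > 0"
  shows "outer_measure_space UNIV (hausdorff_outer m)"
  using hausdorff_outer_empty[OF assms]
  by (auto simp: outer_measure_space_def positive_def increasing_def countably_subadditive_def
      intro: hausdorff_outer_mono hausdorff_outer_countably_subadditive)

lemma hausdorff_outer_subadditive:
  assumes "m > 0"
  shows "hausdorff_outer m (A \<union> B) \<le> hausdorff_outer m A + hausdorff_outer m B"
proof -
  interpret sigma_algebra UNIV "UNIV :: 'a set set"
    using sigma_algebra_Pow[of UNIV] by simp
  have "subadditive UNIV (hausdorff_outer m :: 'a set \<Rightarrow> ennreal)"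
    using hausdorff_outer_space[OF assms] countably_subadditive_subadditive
    unfolding outer_measure_space_def by blast
  then have "hausdorff_outer m (A \<union> (B - A)) \<le> hausdorff_outer m A + hausdorff_outer m (B - A)"
    by (intro subadditiveD) auto
  also have "\<dots> \<le> hausdorff_outer m A + hausdorff_outer m B"
    by (intro add_left_mono hausdorff_outer_mono) auto
  finally show ?thesis by (simp add: Un_Diff_cancel)
qed

lemma hausdorff_outer_separated:
  fixes A B :: "'a::metric_space set"
  assumes m: "m > 0" and d: "d > 0" "\<And>x y. x \<in> A \<Longrightarrow> y \<in> B \<Longrightarrow> d \<le> dist x y"
  shows "hausdorff_outer m A + hausdorff_outer m B \<le> hausdorff_outer m (A \<union> B)"
proof -
  have *: "hausdorff_pre m \<delta> A + hausdorff_pre m \<delta> B \<le> hausdorff_pre m \<delta> (A \<union> B)" if \<delta>: "\<delta> < d" for \<delta>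
    unfolding hausdorff_pre_def[of m \<delta> "A \<union> B"]
  proof (rule INF_greatest, clarify)
    fix E :: "nat \<Rightarrow> 'a set"
    assume cov: "A \<union> B \<subseteq> (\<Union>i. E i)" and E: "\<forall>i. bounded (E i) \<and> diameter (E i) \<le> \<delta>"
    define EA where "EA i = (if E i \<inter> A = {} then {} else E i)" for i
    define EB where "EB i = (if E i \<inter> B = {} then {} else E i)" for i
    have disj: "E i \<inter> A = {} \<or> E i \<inter> B = {}" for i
      using E \<delta> d diameter_bounded_bound[of "E i"] by (meson disjoint_iff le_less_trans not_le order_trans)
    have "\<delta> \<ge> 0" using E diameter_ge_0 order_trans by blast
    have "hausdorff_pre m \<delta> A \<le> (\<Sum>i. hausdorff_weight m (EA i))"
    proof (rule hausdorff_pre_le)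
      show "A \<subseteq> (\<Union>i. EA i)" using cov by (fastforce simp: EA_def)
    qed (use E \<open>\<delta> \<ge> 0\<close> in \<open>auto simp: EA_def\<close>)
    moreover have "hausdorff_pre m \<delta> B \<le> (\<Sum>i. hausdorff_weight m (EB i))"
    proof (rule hausdorff_pre_le)
      show "B \<subseteq> (\<Union>i. EB i)" using cov by (fastforce simp: EB_def)
    qed (use E \<open>\<delta> \<ge> 0\<close> in \<open>auto simp: EB_def\<close>)
    ultimately have "hausdorff_pre m \<delta> A + hausdorff_pre m \<delta> B
        \<le> (\<Sum>i. hausdorff_weight m (EA i)) + (\<Sum>i. hausdorff_weight m (EB i))"
      by (rule add_mono)
    also have "\<dots> = (\<Sum>i. hausdorff_weight m (EA i) + hausdorff_weight m (EB i))"
      by (rule suminf_add) auto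
    also have "\<dots> \<le> (\<Sum>i. hausdorff_weight m (E i))"
      using disj by (intro suminf_le) (auto simp: EA_def EB_def hausdorff_weight_empty[OF m])
    finally show "hausdorff_pre m \<delta> A + hausdorff_pre m \<delta> B \<le> (\<Sum>i. hausdorff_weight m (E i))" .
  qed
  have **: "hausdorff_pre m \<delta> A + hausdorff_pre m \<epsilon> B \<le> hausdorff_outer m (A \<union> B)"
    if "\<delta> > 0" "\<epsilon> > 0" for \<delta> \<epsilon>
  proof -
    define \<eta> where "\<eta> = min (min \<delta> \<epsilon>) (d / 2)"
    have \<eta>: "\<eta> \<le> \<delta>" "\<eta> \<le> \<epsilon>" "\<eta> < d" "\<eta> > 0"
      using that d by (auto simp: \<eta>_def min_def)
    have "hausdorff_pre m \<delta> A + hausdorff_pre m \<epsilon> B \<le> hausdorff_pre m \<eta> A + hausdorff_pre m \<eta> B"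
      by (intro add_mono hausdorff_pre_antimono \<eta>)
    also have "\<dots> \<le> hausdorff_pre m \<eta> (A \<union> B)" by (rule *) fact
    also have "\<dots> \<le> hausdorff_outer m (A \<union> B)" by (rule hausdorff_pre_le_outer) fact
    finally show ?thesis .
  qed
  have ne: "{0<..} \<noteq> ({} :: real set)" by (simp add: greaterThan_non_empty)
  have "hausdorff_pre m \<delta> A + hausdorff_outer m B \<le> hausdorff_outer m (A \<union> B)" if "\<delta> > 0" for \<delta>
    unfolding hausdorff_outer_def[of m B] ennreal_SUP_add_right[OF ne]
    using ** that by (intro SUP_least) auto
  then show ?thesis
    unfolding hausdorff_outer_def[of m A] ennreal_SUP_add_left[OF ne, symmetric]
    by (intro SUP_least) auto
qed

lemma hausdorff_outer_closed:
  fixes A F :: "'a::metric_space set"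
  assumes m: "m > 0" and F: "closed F"
  shows "hausdorff_outer m (A \<inter> F) + hausdorff_outer m (A - F) = hausdorff_outer m A"
proof (rule antisym)
  let ?O = "hausdorff_outer m :: 'a set \<Rightarrow> ennreal"
  have un: "A \<inter> F \<union> (A - F) = A" by blast
  show "?O A \<le> ?O (A \<inter> F) + ?O (A - F)"
    using hausdorff_outer_subadditive[OF m, of "A \<inter> F" "A - F"] by (simp only: un)
  show "?O (A \<inter> F) + ?O (A - F) \<le> ?O A"
  proof (cases "?O A = top \<or> F = {}")
    case True
    then show ?thesis using hausdorff_outer_empty[OF m, where 'a='a] by auto
  next
    case False
    define R where "R k = {x \<in> A. inverse (real (k + 2)) \<le> infdist x F \<and> infdist x F < inverse (real (k + 1))}" for k
    define S where "S n = {x \<in> A. inverse (real (n + 1)) \<le> infdist x F}" for n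
    have RA: "R k \<subseteq> A" for k by (auto simp: R_def)
    have half: "(\<Sum>j. ?O (R (2 * j + p))) \<le> ?O A" for p
    proof (rule suminf_le_const[OF summableI])
      fix n
      have "(\<Sum>j<n. ?O (R (2 * j + p))) \<le> ?O (\<Union>j<n. R (2 * j + p))"
      proof (induction n)
        case 0
        then show ?case by simp
      next
        case (Suc n)
        define d where "d = inverse (real (2 * n + p)) - inverse (real (2 * n + p + 1))"
        have eq: "(\<Union>j<Suc n. R (2 * j + p)) = (\<Union>j<n. R (2 * j + p)) \<union> R (2 * n + p)"
          by (auto simp: less_Suc_eq)
        have "?O (\<Union>j<n. R (2 * j + p)) + ?O (R (2 * n + p))
            \<le> ?O ((\<Union>j<n. R (2 * j + p)) \<union> R (2 * n + p))"
        proof (cases n)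
          case 0
          then show ?thesis by (simp add: hausdorff_outer_empty[OF m])
        next
          case (Suc n')
          show ?thesis
          proof (rule hausdorff_outer_separated[OF m])
            show "d > 0" using Suc by (simp add: d_def)
            fix x y assume "x \<in> (\<Union>j<n. R (2 * j + p))" and y: "y \<in> R (2 * n + p)"
            then obtain j where j: "j < n" "x \<in> R (2 * j + p)" by auto
            have "inverse (real (2 * n + p)) \<le> inverse (real (2 * j + p + 2))"
              using j by (intro le_imp_inverse_le) auto
            also have "\<dots> \<le> infdist x F" using j by (simp add: R_def)
            finally have "inverse (real (2 * n + p)) \<le> infdist x F" .
            moreover have "infdist y F < inverse (real (2 * n + p + 1))"
              using y by (simp add: R_def)
            ultimately show "d \<le> dist x y"
              using infdist_triangle_abs[of x F y] unfolding d_def by linarith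
          qed
        qed
        then show ?case
          unfolding eq sum.lessThan_Suc by (rule order_trans[OF add_right_mono[OF Suc.IH]])
      qed
      also have "\<dots> \<le> ?O A" by (rule hausdorff_outer_mono) (use RA in blast)
      finally show "(\<Sum>j<n. ?O (R (2 * j + p))) \<le> ?O A" .
    qed
    have fin: "(\<Sum>k. ?O (R k)) \<noteq> top"
    proof -
      have "(\<Sum>k<n. ?O (R k)) \<le> ?O A + ?O A" for n
      proof -
        have "(\<Sum>k<n. ?O (R k)) \<le> (\<Sum>k<2*n. ?O (R k))"
          by (rule sum_mono2) auto
        also have "\<dots> = (\<Sum>j<n. ?O (R (2 * j + 0))) + (\<Sum>j<n. ?O (R (2 * j + 1)))"
          by (induction n) (simp_all add: algebra_simps)
        also have "\<dots> \<le> (\<Sum>j. ?O (R (2 * j + 0))) + (\<Sum>j. ?O (R (2 * j + 1)))"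
          by (intro add_mono sum_le_suminf) auto
        also have "\<dots> \<le> ?O A + ?O A" by (intro add_mono half)
        finally show ?thesis .
      qed
      then have "(\<Sum>k. ?O (R k)) \<le> ?O A + ?O A"
        by (intro suminf_le_const) auto
      moreover have "?O A + ?O A < top" using False by (simp add: less_top)
      ultimately show ?thesis by (auto simp: top_unique)
    qed
    have bound: "?O (A \<inter> F) + ?O (A - F) \<le> ?O A + (\<Sum>k. ?O (R (k + n)))" for n
    proof -
      have "A - F \<subseteq> S n \<union> (\<Union>k. R (k + n))"
      proof
        fix x assume x: "x \<in> A - F"
        show "x \<in> S n \<union> (\<Union>k. R (k + n))"
        proof (cases "x \<in> S n")
          case False
          have pos: "infdist x F > 0"
            using x F \<open>\<not> (?O A = top \<or> F = {})\<close> infdist_pos_not_in_closed[of F x] by auto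
          define l where "l = (LEAST l. inverse (real (l + 1)) \<le> infdist x F)"
          have ex: "\<exists>l. inverse (real (l + 1)) \<le> infdist x F"
            using reals_Archimedean[OF pos] by (metis less_imp_le of_nat_Suc Suc_eq_plus1)
          have l: "inverse (real (l + 1)) \<le> infdist x F"
            unfolding l_def by (rule LeastI_ex[OF ex])
          have "l > n"
          proof (rule ccontr)
            assume "\<not> l > n"
            then have "inverse (real (n + 1)) \<le> inverse (real (l + 1))"
              by (intro le_imp_inverse_le) auto
            then have "x \<in> S n" using order_trans[OF _ l] x by (simp add: S_def)
            then show False using \<open>x \<notin> S n\<close> by blast
          qed
          then obtain k where k: "l = Suc (k + n)"
            by (metis add.commute less_iff_Suc_add)
          have "\<not> inverse (real (k + n + 1)) \<le> infdist x F"
            using not_less_Least[of "k + n" "\<lambda>l. inverse (real (l + 1)) \<le> infdist x F"] k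
            unfolding l_def by auto
          then have "x \<in> R (k + n)" using l x k by (simp add: R_def add.commute)
          then show ?thesis by blast
        qed simp
      qed
      then have "?O (A - F) \<le> ?O (S n \<union> (\<Union>k. R (k + n)))" by (rule hausdorff_outer_mono)
      also have "\<dots> \<le> ?O (S n) + ?O (\<Union>k. R (k + n))" by (rule hausdorff_outer_subadditive[OF m])
      also have "\<dots> \<le> ?O (S n) + (\<Sum>k. ?O (R (k + n)))"
        by (intro add_left_mono hausdorff_outer_countably_subadditive)
      finally have "?O (A \<inter> F) + ?O (A - F) \<le> (?O (A \<inter> F) + ?O (S n)) + (\<Sum>k. ?O (R (k + n)))"
        by (simp add: add.assoc add_left_mono)
      also have "?O (A \<inter> F) + ?O (S n) \<le> ?O (A \<inter> F \<union> S n)"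
      proof (rule hausdorff_outer_separated[OF m])
        show "inverse (real (n + 1)) > 0" by simp
        fix x y assume x: "x \<in> A \<inter> F" and y: "y \<in> S n"
        have "infdist y F \<le> dist y x" using x by (intro infdist_le) auto
        then show "inverse (real (n + 1)) \<le> dist x y" using y by (simp add: S_def dist_commute)
      qed
      also have "\<dots> \<le> ?O A" by (rule hausdorff_outer_mono) (auto simp: S_def)
      finally show ?thesis by (simp add: add_right_mono)
    qed
    define r where "r k = enn2real (?O (R k))" for k
    have nt: "?O (R k) \<noteq> top" for k using ennreal_suminf_lessD[of "\<lambda>k. ?O (R k)" top k] fin
      by (auto simp: less_top)
    then have r: "?O (R k) = ennreal (r k)" for k by (simp add: r_def less_top)
    have r0: "r k \<ge> 0" for k by (simp add: r_def)
    have sr: "summable r"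
      using fin r0 unfolding r by (intro summable_suminf_not_top) auto
    have tail: "(\<Sum>k. ?O (R (k + n))) = ennreal (\<Sum>k. r (k + n))" for n
      unfolding r using sr r0 by (intro suminf_ennreal2) (auto intro: summable_ignore_initial_segment)
    have "(\<lambda>n. ?O A + ennreal (\<Sum>k. r (k + n))) \<longlonglongrightarrow> ?O A + ennreal 0"
      by (intro tendsto_add tendsto_const tendsto_ennrealI suminf_exist_split2[OF sr])
    then show ?thesis
      using bound unfolding tail by (intro LIMSEQ_le_const) auto
  qed
qed

lemma emeasure_hausdorff_measure:
  fixes A :: "'a::metric_space set"
  assumes m: "m > 0" and A: "A \<in> sets borel"
  shows "emeasure (hausdorff_measure m) A = hausdorff_outer m A"
proof -
  interpret P: sigma_algebra UNIV "UNIV :: 'a set set"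
    using sigma_algebra_Pow[of UNIV] by simp
  let ?L = "lambda_system UNIV UNIV (hausdorff_outer m :: 'a set \<Rightarrow> ennreal)"
  have L: "measure_space UNIV ?L (hausdorff_outer m)"
    by (rule P.caratheodory_lemma[OF hausdorff_outer_space[OF m]])
  then interpret L: sigma_algebra UNIV ?L by (simp add: measure_space_def)
  have "Collect closed \<subseteq> ?L"
    unfolding P.lambda_system_eq by (auto simp: hausdorff_outer_closed[OF m])
  then have "sets borel \<subseteq> ?L"
    unfolding borel_eq_closed by (simp add: L.sigma_sets_subset)
  with L sets.sigma_algebra_axioms[of "borel :: 'a measure"]
  have "measure_space UNIV (sets (borel :: 'a measure)) (hausdorff_outer m)"
    by (intro measure_down[OF L]) auto
  then show ?thesis
    unfolding hausdorff_measure_def using A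
    by (intro emeasure_measure_of_sigma) (auto simp: measure_space_def)
qed

section \<open>Metric surfaces\<close>

definition metric_surface :: "'a::metric_space itself \<Rightarrow> bool" where
  "metric_surface _ \<longleftrightarrow>
     (\<forall>x::'a. \<exists>U. open U \<and> x \<in> U \<and> (\<exists>V::(real^2) set. open V \<and> U homeomorphic V)) \<and>
     (\<forall>C::'a set. compact C \<longrightarrow> emeasure (hausdorff_measure 2) C < \<infinity>)"

section \<open>Paths and path integrals\<close>

text \<open>
  Paths are parametrized by the unit interval, as in the library constant \<^const>\<open>path\<close>; only the
  values on that interval matter below.
\<close>

definition path_length :: "(real \<Rightarrow> 'a::metric_space) \<Rightarrow> ennreal" where
  "path_length \<gamma> =
     (SUP (n, t) \<in> {(n, t). mono_on {..n} t \<and> t ` {..n} \<subseteq> {0..1}}.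
        \<Sum>i<n. ennreal (dist (\<gamma> (t i)) (\<gamma> (t (Suc i)))))"

definition rectifiable :: "(real \<Rightarrow> 'a::metric_space) \<Rightarrow> bool" where
  "rectifiable \<gamma> \<longleftrightarrow> path \<gamma> \<and> path_length \<gamma> < \<infinity>"

text \<open>The counting measure gives the number of preimages, which is \<open>\<infinity>\<close> for infinitely many.\<close>

definition path_nn_integral :: "(real \<Rightarrow> 'a::metric_space) \<Rightarrow> ('a \<Rightarrow> ennreal) \<Rightarrow> ennreal" where
  "path_nn_integral \<gamma> \<rho> =
     (\<integral>\<^sup>+x. emeasure (count_space UNIV) {t \<in> {0..1}. \<gamma> t = x} * \<rho> x \<partial>hausdorff_measure 1)"

section \<open>Upper gradients and weakly monotone functions\<close>

definition upper_gradient :: "('a::metric_space \<Rightarrow> real) \<Rightarrow> ('a \<Rightarrow> ennreal) \<Rightarrow> bool" where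
  "upper_gradient u \<rho> \<longleftrightarrow>
     \<rho> \<in> borel_measurable borel \<and>
     (\<forall>\<gamma>. rectifiable \<gamma> \<longrightarrow>
        ennreal \<bar>u (pathstart \<gamma>) - u (pathfinish \<gamma>)\<bar> \<le> path_nn_integral \<gamma> \<rho>)"

definition locally_2_integrable :: "('a::metric_space \<Rightarrow> ennreal) \<Rightarrow> bool" where
  "locally_2_integrable \<rho> \<longleftrightarrow>
     (\<forall>C. compact C \<longrightarrow> (\<integral>\<^sup>+x\<in>C. \<rho> x ^ 2 \<partial>hausdorff_measure 2) < \<infinity>)"

text \<open>
  Suprema and infima are taken in the extended reals, with \<open>-\<infinity>\<close> and \<open>\<infinity>\<close> as their values on the
  empty set.
\<close>

definition weakly_monotone :: "('a::metric_space \<Rightarrow> real) \<Rightarrow> bool" where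
  "weakly_monotone u \<longleftrightarrow>
     (\<forall>V. open V \<and> compact (closure V) \<longrightarrow>
        (SUP x\<in>V. ereal (u x)) \<le> (SUP x\<in>frontier V. ereal (u x)) \<and>
        (SUP x\<in>frontier V. ereal (u x)) < \<infinity> \<and>
        (INF x\<in>V. ereal (u x)) \<ge> (INF x\<in>frontier V. ereal (u x)) \<and>
        (INF x\<in>frontier V. ereal (u x)) > -\<infinity>)"

section \<open>Modulus and weakly quasiconformal maps\<close>

definition modulus2 :: "(real \<Rightarrow> 'a::metric_space) set \<Rightarrow> ennreal" where
  "modulus2 \<Gamma> =
     (INF \<rho> \<in> {\<rho> \<in> borel_measurable borel. \<forall>\<gamma>\<in>\<Gamma>. 1 \<le> path_nn_integral \<gamma> \<rho>}.
        \<integral>\<^sup>+x. \<rho> x ^ 2 \<partial>hausdorff_measure 2)"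

definition weakly_K_quasiconformal ::
    "real \<Rightarrow> ('a::metric_space \<Rightarrow> 'b::metric_space) \<Rightarrow> bool" where
  "weakly_K_quasiconformal K f \<longleftrightarrow>
     K \<ge> 1 \<and>
     (\<exists>h. (\<forall>n::nat. \<exists>g. homeomorphism UNIV UNIV (h n) g) \<and> uniform_limit UNIV h f sequentially) \<and>
     (\<forall>\<Gamma>. (\<forall>\<gamma>\<in>\<Gamma>. path \<gamma>) \<longrightarrow> modulus2 \<Gamma> \<le> ennreal K * modulus2 ((\<lambda>\<gamma>. f \<circ> \<gamma>) ` \<Gamma>))"

definition weakly_quasiconformal :: "('a::metric_space \<Rightarrow> 'b::metric_space) \<Rightarrow> bool" where
  "weakly_quasiconformal f \<longleftrightarrow> (\<exists>K. weakly_K_quasiconformal K f)"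

end

theory Submission
  imports Defs
begin

text \<open>
  Weak monotonicity passes to \<open>u \<circ> f\<close> because \<open>W = f ` V - f ` frontier V\<close> is open with frontier
  inside \<open>f ` frontier V\<close>, so that weak monotonicity of \<open>u\<close> applies to \<open>W\<close>.

  For the upper gradient, let \<open>\<sigma>\<close> be square-integrable on the target.  The function \<open>\<sigma> / \<epsilon>\<close> is
  admissible for the images of all paths \<open>\<gamma>\<close> with \<open>\<integral> \<sigma> \<ge> \<epsilon>\<close> along \<open>f \<circ> \<gamma>\<close>, so the modulus inequality
  gives an admissible function \<open>r\<close> for these paths such that the energy of \<open>\<epsilon> r\<close> is bounded independently
  of \<open>\<epsilon>\<close>.  Cutting a path into pieces of \<open>\<sigma>\<close>-length \<open>\<epsilon>\<close> shows that the integral of \<open>\<epsilon> r\<close> along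
  \<open>\<gamma>\<close> is at least the integral of \<open>\<sigma>\<close> along \<open>f \<circ> \<gamma>\<close> minus \<open>\<epsilon>\<close>, and a limit \<open>\<epsilon> \<longrightarrow> 0\<close> of such
  functions loses nothing.  With \<open>\<sigma> = 1 + \<rho>\<close> on the image of a compact set, where \<open>\<rho>\<close> is the upper
  gradient of \<open>u\<close>, the summand \<open>1\<close> takes care of the paths with nonrectifiable image.  The resulting
  functions on compact sets are glued together along an exhaustion of each component.
\<close>

section \<open>Square-integrable functions\<close>

text \<open>For each \<epsilon> the modulus inequality yields a function that depends on \<epsilon>,
  and an upper gradient must serve every rectifiable path, not almost every one. A weak limit of
  these functions would leave an exceptional family of paths. Instead, one square-integrable
  function is built that dominates, at every point, some member of each class of approximate
  solutions; path integrals are monotone, so no path is lost. Paths along whose image the integral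
  of \<sigma> is infinite cannot be cut into finitely many pieces of length \<epsilon> with a short
  remainder; a separate square-integrable summand has infinite integral along each of them.

  Gluing is delicate because a metric surface may have uncountably many components. Each has a
  countable exhaustion, but a function that is Borel on every component need not be Borel on the
  whole space, and null sets chosen in each component need not have a null union. Hence the passage
  to functions described by open sets, and integrability estimates that stay within one
  component.\<close>

lemma ennreal_power2_add_le:
  fixes x y :: ennreal
  shows "(x + y)\<^sup>2 \<le> 2 * x\<^sup>2 + 2 * y\<^sup>2"
proof (cases x; cases y)
  fix r s :: real assume *: "x = ennreal r" "0 \<le> r" "y = ennreal s" "0 \<le> s"
  have "(r + s)\<^sup>2 \<le> 2 * r\<^sup>2 + 2 * s\<^sup>2"
    using sum_squares_bound[of r s] by (simp add: power2_sum)
  then have "ennreal ((r + s)\<^sup>2) \<le> ennreal (2 * r\<^sup>2 + 2 * s\<^sup>2)" by (rule ennreal_leI)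
  also have "\<dots> = 2 * x\<^sup>2 + 2 * y\<^sup>2" using * by (simp add: ennreal_power ennreal_mult)
  finally show ?thesis using * by (simp add: ennreal_power flip: ennreal_plus)
qed (auto simp: power2_eq_square ennreal_mult_top ennreal_top_mult)

text \<open>Subtraction on \<open>ennreal\<close> is truncated, so \<open>y - x\<close> is only the
  positive part of the difference and the parallelogram law becomes an inequality. The positive part
  suffices for building a majorant. The case \<open>x = y = top\<close> has to be kept apart, since
  \<open>top - top = top\<close>.\<close>

lemma ennreal_parallelogram_le:
  fixes x y :: ennreal
  shows "(y - x)\<^sup>2 + (x + y)\<^sup>2 \<le> 2 * x\<^sup>2 + 2 * y\<^sup>2"
proof (cases "y \<le> x \<and> y < top")
  case True
  then show ?thesis using ennreal_power2_add_le[of x y] by (simp add: diff_eq_0_ennreal)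
next
  case False
  then show ?thesis
  proof (cases x; cases y)
    fix r s :: real assume *: "x = ennreal r" "0 \<le> r" "y = ennreal s" "0 \<le> s"
    then have "r \<le> s" using False by (simp add: not_le ennreal_less_iff)
    have "ennreal ((s - r)\<^sup>2 + (r + s)\<^sup>2) \<le> ennreal (2 * r\<^sup>2 + 2 * s\<^sup>2)"
      by (intro ennreal_leI) (simp add: power2_sum power2_diff)
    also have "\<dots> = 2 * x\<^sup>2 + 2 * y\<^sup>2" using * by (simp add: ennreal_power ennreal_mult)
    also have "ennreal ((s - r)\<^sup>2 + (r + s)\<^sup>2) = (y - x)\<^sup>2 + (x + y)\<^sup>2"
      using * \<open>r \<le> s\<close> by (simp add: ennreal_power ennreal_minus flip: ennreal_plus)
    finally show ?thesis .
  qed (auto simp: power2_eq_square ennreal_mult_top ennreal_top_mult)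
qed

text \<open>Splitting off the first term doubles both squares; repeating this on the rest gives the
  k-th term the factor \<open>2 ^ (k + 1)\<close>. The weights grow, but they are independent of
  \<open>n\<close>, so the estimate passes to infinite series.\<close>

lemma ennreal_sum_power2_le:
  fixes a :: "nat \<Rightarrow> ennreal"
  shows "(\<Sum>k<n. a k)\<^sup>2 \<le> (\<Sum>k<n. 2 ^ (k + 1) * (a k)\<^sup>2)"
proof (induction n arbitrary: a)
  case (Suc n)
  have "(\<Sum>k<Suc n. a k)\<^sup>2 \<le> 2 * (a 0)\<^sup>2 + 2 * (\<Sum>k<n. a (Suc k))\<^sup>2"
    unfolding sum.lessThan_Suc_shift by (rule ennreal_power2_add_le)
  also have "\<dots> \<le> 2 * (a 0)\<^sup>2 + 2 * (\<Sum>k<n. 2 ^ (k + 1) * (a (Suc k))\<^sup>2)"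
    by (intro add_left_mono mult_left_mono Suc.IH) auto
  also have "\<dots> = (\<Sum>k<Suc n. 2 ^ (k + 1) * (a k)\<^sup>2)"
    unfolding sum.lessThan_Suc_shift by (simp add: sum_distrib_left mult.assoc)
  finally show ?case .
qed simp

lemma ennreal_suminf_power2_le:
  fixes a :: "nat \<Rightarrow> ennreal"
  shows "(\<Sum>k. a k)\<^sup>2 \<le> (\<Sum>k. 2 ^ (k + 1) * (a k)\<^sup>2)"
proof -
  let ?s = "\<lambda>n. \<Sum>k<n. a k"
  have mono: "?s n \<le> ?s m" if "n \<le> m" for n m
    using that by (intro sum_mono2) auto
  \<comment> \<open>The square of a supremum unfolds into a supremum over two independent indices,
    so mixed products of partial sums have to be bounded as well.\<close>
  have *: "?s n * ?s m \<le> (\<Sum>k. 2 ^ (k + 1) * (a k)\<^sup>2)" for n m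
  proof -
    have "?s n * ?s m \<le> (?s (max n m))\<^sup>2"
      unfolding power2_eq_square by (intro mult_mono mono) auto
    also have "\<dots> \<le> (\<Sum>k<max n m. 2 ^ (k + 1) * (a k)\<^sup>2)" by (rule ennreal_sum_power2_le)
    also have "\<dots> \<le> (\<Sum>k. 2 ^ (k + 1) * (a k)\<^sup>2)" by (intro sum_le_suminf) auto
    finally show ?thesis .
  qed
  show ?thesis
    unfolding suminf_eq_SUP[of a] power2_eq_square[of "SUP n. ?s n"]
      SUP_mult_right_ennreal SUP_mult_left_ennreal
    by (intro SUP_least *)
qed

lemma nn_integral_suminf_power2_le:
  assumes [measurable]: "\<And>k. a k \<in> borel_measurable M"
  shows "(\<integral>\<^sup>+x. (\<Sum>k. a k x)\<^sup>2 \<partial>M) \<le> (\<Sum>k. 2 ^ (k + 1) * (\<integral>\<^sup>+x. (a k x)\<^sup>2 \<partial>M))"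
proof -
  have "(\<integral>\<^sup>+x. (\<Sum>k. a k x)\<^sup>2 \<partial>M) \<le> (\<integral>\<^sup>+x. (\<Sum>k. 2 ^ (k + 1) * (a k x)\<^sup>2) \<partial>M)"
    by (intro nn_integral_mono ennreal_suminf_power2_le)
  also have "\<dots> = (\<Sum>k. 2 ^ (k + 1) * (\<integral>\<^sup>+x. (a k x)\<^sup>2 \<partial>M))"
    by (simp add: nn_integral_suminf nn_integral_cmult)
  finally show ?thesis .
qed

text \<open>The decay \<open>(1/4) ^ k\<close> beats the weights \<open>2 ^ (k + 1)\<close> and
  leaves a geometric series of ratio 1/2.\<close>

lemma nn_integral_suminf_power2_finite:
  assumes [measurable]: "\<And>k. a k \<in> borel_measurable M"
    and le: "\<And>k. (\<integral>\<^sup>+x. (a k x)\<^sup>2 \<partial>M) \<le> ennreal (c * (1/4) ^ k)" and "c \<ge> 0"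
  shows "(\<integral>\<^sup>+x. (\<Sum>k. a k x)\<^sup>2 \<partial>M) < \<infinity>"
proof -
  have "(\<integral>\<^sup>+x. (\<Sum>k. a k x)\<^sup>2 \<partial>M) \<le> (\<Sum>k. 2 ^ (k + 1) * (\<integral>\<^sup>+x. (a k x)\<^sup>2 \<partial>M))"
    by (rule nn_integral_suminf_power2_le) fact
  also have "\<dots> \<le> (\<Sum>k. 2 ^ (k + 1) * ennreal (c * (1/4) ^ k))"
    by (intro suminf_le mult_left_mono le) auto
  also have "\<dots> = (\<Sum>k. ennreal (2 * c * (1/2) ^ k))"
  proof (intro suminf_cong)
    fix k
    have "(2::real) ^ (k + 1) * (c * (1/4) ^ k) = 2 * c * (1/2) ^ k"
      by (simp add: power_divide field_simps flip: power_mult_distrib)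
    then show "2 ^ (k + 1) * ennreal (c * (1/4) ^ k) = ennreal (2 * c * (1/2) ^ k)"
      using \<open>c \<ge> 0\<close>
      by (metis ennreal_mult'' ennreal_numeral ennreal_power mult_nonneg_nonneg zero_le_divide_1_iff
          zero_le_numeral zero_le_power)
  qed
  also have "\<dots> < \<infinity>"
  proof -
    have "summable (\<lambda>k. 2 * c * (1/2::real) ^ k)" by (intro summable_mult summable_geometric) auto
    then show ?thesis using \<open>c \<ge> 0\<close> by (subst suminf_ennreal2) auto
  qed
  finally show ?thesis .
qed

text \<open>
  Near-minimizers of the energy over a decreasing sequence of convex sets form a Cauchy sequence by
  the parallelogram law, and a rapidly converging sequence has a square-integrable majorant.  This
  replaces weak compactness of bounded sets in the space of square-integrable functions.
\<close>

lemma square_integrable_majorant: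
  fixes S :: "nat \<Rightarrow> ('a \<Rightarrow> ennreal) set"
  assumes meas: "\<And>n x. x \<in> S n \<Longrightarrow> x \<in> borel_measurable M"
    and dec: "decseq S"
    and mid: "\<And>n x y. x \<in> S n \<Longrightarrow> y \<in> S n \<Longrightarrow> (\<lambda>t. (x t + y t) / 2) \<in> S n"
    and bound: "\<And>n. \<exists>x\<in>S n. (\<integral>\<^sup>+t. (x t)\<^sup>2 \<partial>M) \<le> B" and B: "B < \<infinity>"
  shows "\<exists>G\<in>borel_measurable M. (\<integral>\<^sup>+t. (G t)\<^sup>2 \<partial>M) < \<infinity> \<and> (\<forall>n. \<exists>x\<in>S n. \<forall>t. x t \<le> G t)"
proof -
  define E where "E x = (\<integral>\<^sup>+t. (x t)\<^sup>2 \<partial>M)" for x :: "'a \<Rightarrow> ennreal"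
  define d where "d n = (INF x\<in>S n. E x)" for n
  define D where "D = (SUP n. d n)"
  define \<delta> :: "nat \<Rightarrow> real" where "\<delta> k = (1/4) ^ k" for k
  have \<delta>: "\<delta> k > 0" "\<delta> (Suc k) \<le> \<delta> k" for k by (auto simp: \<delta>_def)
  have dB: "d n \<le> B" for n
    using bound[of n] unfolding d_def E_def by (auto intro: INF_lower2)
  have dD: "d n \<le> D" for n unfolding D_def by (rule SUP_upper) simp
  have "D \<le> B" unfolding D_def by (intro SUP_least dB)
  then have D: "D < \<infinity>" using B by (rule le_less_trans)
  have dmono: "d n \<le> d m" if "n \<le> m" for n m
    unfolding d_def using decseqD[OF dec that] by (rule INF_superset_mono) simp
  have "\<exists>N. D \<le> d N + ennreal (\<delta> k)" for k
    using SUP_approx_ennreal[OF \<delta>(1)[of k] UNIV_not_empty D_def] D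
    by (auto intro: less_imp_le)
  then obtain N where N: "\<And>k. D \<le> d (N k) + ennreal (\<delta> k)" by metis
  \<comment> \<open>The sum makes \<open>m\<close> increasing and at least \<open>N k\<close>; the
    summand \<open>k\<close> gives \<open>m k \<ge> k\<close>, so that every \<open>S n\<close> is
    reached.\<close>
  define m where "m k = k + (\<Sum>j\<le>k. N j)" for k
  have mmono: "m k \<le> m (Suc k)" for k by (simp add: m_def)
  have Dm: "D \<le> d (m k) + ennreal (\<delta> k)" for k
  proof -
    have "N k \<le> (\<Sum>j\<le>k. N j)" by (intro member_le_sum) auto
    then have "d (N k) \<le> d (m k)" by (intro dmono) (simp add: m_def)
    then show ?thesis using N[of k] by (meson add_right_mono order_trans)
  qed
  have "\<exists>x\<in>S (m k). E x \<le> D + ennreal (\<delta> k)" for k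
  proof -
    have ne: "S (m k) \<noteq> {}" using bound[of "m k"] by auto
    have dn: "d (m k) \<noteq> \<infinity>" using dB[of "m k"] B by (auto simp: top_unique)
    have "\<exists>x\<in>S (m k). E x < d (m k) + ennreal (\<delta> k)"
      by (rule INF_approx_ennreal[OF _ _ dn]) (use \<delta>(1)[of k] in \<open>auto simp: d_def\<close>)
    then show ?thesis using dD[of "m k"]
      by (meson add_right_mono less_imp_le order_trans)
  qed
  then obtain x where x: "\<And>k. x k \<in> S (m k)" and Ex: "\<And>k. E (x k) \<le> D + ennreal (\<delta> k)"
    by metis
  have [measurable]: "x k \<in> borel_measurable M" for k using meas x by blast
  define e where "e k t = x (Suc k) t - x k t" for k t
  have [measurable]: "e k \<in> borel_measurable M" for k unfolding e_def by measurable
  \<comment> \<open>Both \<open>x k\<close> and \<open>x (Suc k)\<close> lie in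
    \<open>S (m k)\<close>, so their midpoint has energy at least \<open>d (m k)\<close>, while
    their own energies exceed \<open>d (m k)\<close> by at most \<open>2 * \<delta> k\<close>. The
    parallelogram inequality leaves \<open>8 * \<delta> k\<close> for the increment.\<close>
  have Ee: "E (e k) \<le> ennreal (8 * (1/4) ^ k)" for k
  proof -
    have xS: "x (Suc k) \<in> S (m k)" using decseqD[OF dec mmono[of k]] x by blast
    have "4 * d (m k) \<le> 4 * E (\<lambda>t. (x k t + x (Suc k) t) / 2)"
      unfolding d_def by (intro mult_left_mono INF_lower mid x xS) auto
    also have "\<dots> = (\<integral>\<^sup>+t. 4 * ((x k t + x (Suc k) t) / 2)\<^sup>2 \<partial>M)"
      unfolding E_def by (rule nn_integral_cmult[symmetric]) measurable
    also have "\<dots> = (\<integral>\<^sup>+t. (x k t + x (Suc k) t)\<^sup>2 \<partial>M)"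
    proof (intro nn_integral_cong)
      fix t
      have "4 * (z / 2)\<^sup>2 = z\<^sup>2" for z :: ennreal
      proof (cases z)
        case (real r)
        then show ?thesis
          by (simp add: ennreal_power divide_ennreal ennreal_mult''[symmetric] power_divide flip: ennreal_numeral)
      qed (simp add: power2_eq_square ennreal_mult_top ennreal_top_mult ennreal_top_divide)
      then show "4 * ((x k t + x (Suc k) t) / 2)\<^sup>2 = (x k t + x (Suc k) t)\<^sup>2" .
    qed
    finally have 4: "4 * d (m k) \<le> (\<integral>\<^sup>+t. (x k t + x (Suc k) t)\<^sup>2 \<partial>M)" .
    have "E (e k) + 4 * d (m k) \<le> E (e k) + (\<integral>\<^sup>+t. (x k t + x (Suc k) t)\<^sup>2 \<partial>M)"
      by (intro add_left_mono 4)
    also have "\<dots> = (\<integral>\<^sup>+t. (e k t)\<^sup>2 + (x k t + x (Suc k) t)\<^sup>2 \<partial>M)"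
      unfolding E_def by (subst nn_integral_add) auto
    also have "\<dots> \<le> (\<integral>\<^sup>+t. 2 * (x k t)\<^sup>2 + 2 * (x (Suc k) t)\<^sup>2 \<partial>M)"
      unfolding e_def by (intro nn_integral_mono ennreal_parallelogram_le)
    also have "\<dots> = 2 * E (x k) + 2 * E (x (Suc k))"
      unfolding E_def by (subst nn_integral_add) (auto simp: nn_integral_cmult)
    also have "\<dots> \<le> 2 * (D + ennreal (\<delta> k)) + 2 * (D + ennreal (\<delta> k))"
      by (intro add_mono mult_left_mono Ex order_trans[OF Ex add_left_mono[OF ennreal_leI[OF \<delta>(2)]]]) auto
    also have "\<dots> \<le> 4 * (D + ennreal (\<delta> k))"
      by (subst distrib_right[symmetric]) simp
    also have "\<dots> \<le> 4 * (d (m k) + ennreal (\<delta> k) + ennreal (\<delta> k))"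
      by (intro mult_left_mono add_right_mono Dm) auto
    also have "\<dots> = 4 * (ennreal (\<delta> k) + ennreal (\<delta> k)) + 4 * d (m k)"
      by (simp add: algebra_simps)
    also have "4 * (ennreal (\<delta> k) + ennreal (\<delta> k)) = ennreal (8 * (1/4) ^ k)"
      using \<delta>(1)[of k] by (simp add: \<delta>_def ennreal_mult''[symmetric] flip: ennreal_plus ennreal_numeral)
    finally have le: "E (e k) + 4 * d (m k) \<le> ennreal (8 * (1/4) ^ k) + 4 * d (m k)" .
    have "4 * d (m k) < top"
      using le_less_trans[OF dB[of "m k"] B] by (simp add: ennreal_mult_less_top)
    then show ?thesis
      using le by (auto simp: ennreal_add_left_cancel_le add.commute[of _ "4 * d (m k)"])
  qed
  \<comment> \<open>Only upward increments are added, so \<open>G\<close> is in general not the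
    limit of \<open>x k\<close> but a function above all of them.\<close>
  define G where "G t = x 0 t + (\<Sum>k. e k t)" for t
  have [measurable]: "G \<in> borel_measurable M" unfolding G_def by measurable
  have xG: "x k t \<le> G t" for k t
  proof -
    have "x k t \<le> x 0 t + (\<Sum>j<k. e j t)"
    proof (induction k)
      case (Suc k)
      have "x (Suc k) t \<le> x k t + e k t"
        unfolding e_def by (metis add.commute diff_add_cancel_ennreal le_cases add_increasing2 zero_le order_refl)
      also have "\<dots> \<le> (x 0 t + (\<Sum>j<k. e j t)) + e k t" by (intro add_right_mono Suc.IH)
      finally show ?case by (simp add: add.assoc)
    qed simp
    also have "\<dots> \<le> G t" unfolding G_def by (intro add_left_mono sum_le_suminf) auto
    finally show ?thesis .
  qed
  have "(\<integral>\<^sup>+t. (G t)\<^sup>2 \<partial>M) \<le> (\<integral>\<^sup>+t. 2 * (x 0 t)\<^sup>2 + 2 * (\<Sum>k. e k t)\<^sup>2 \<partial>M)"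
    unfolding G_def by (intro nn_integral_mono ennreal_power2_add_le)
  also have "\<dots> = 2 * E (x 0) + 2 * (\<integral>\<^sup>+t. (\<Sum>k. e k t)\<^sup>2 \<partial>M)"
    unfolding E_def by (subst nn_integral_add) (auto simp: nn_integral_cmult)
  also have "\<dots> < \<infinity>"
  proof -
    have "E (x 0) < \<infinity>"
      using le_less_trans[OF Ex[of 0]] D by (simp add: less_top)
    moreover have "(\<integral>\<^sup>+t. (\<Sum>k. e k t)\<^sup>2 \<partial>M) < \<infinity>"
      by (rule nn_integral_suminf_power2_finite[where c=8]) (use Ee in \<open>auto simp: E_def\<close>)
    ultimately show ?thesis by (simp add: ennreal_mult_less_top)
  qed
  finally have "(\<integral>\<^sup>+t. (G t)\<^sup>2 \<partial>M) < \<infinity>" .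
  moreover have "\<exists>x\<in>S n. \<forall>t. x t \<le> G t" for n
  proof -
    have "m n \<ge> n" by (simp add: m_def)
    then have "x n \<in> S n" using x[of n] decseqD[OF dec] by blast
    then show ?thesis using xG by blast
  qed
  ultimately show ?thesis by (intro bexI[of _ G]) auto
qed

section \<open>Hausdorff measure and integrals along curves\<close>

lemma emeasure_hausdorff_measure_singleton:
  assumes "m > 0"
  shows "emeasure (hausdorff_measure m) {x} = 0"
proof -
  have "hausdorff_pre m \<delta> {x} \<le> 0" if "\<delta> > 0" for \<delta>
  proof -
    have "hausdorff_pre m \<delta> {x} \<le> (\<Sum>i::nat. hausdorff_weight m {x})"
      using that by (intro hausdorff_pre_le) auto
    then show ?thesis using assms by (simp add: hausdorff_weight_def power_0_left)
  qed
  then have "hausdorff_outer m {x} \<le> 0" unfolding hausdorff_outer_def by (intro SUP_least) auto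
  then show ?thesis using assms by (simp add: emeasure_hausdorff_measure)
qed

text \<open>The 1-Lipschitz function \<open>dist p\<close> maps \<open>S\<close> onto a set
  containing the interval from 0 to \<open>dist p q\<close>, and each covering set into an interval
  as long as its diameter. Countable subadditivity of Lebesgue measure compares the two. The scale 1
  is arbitrary.\<close>

lemma dist_le_hausdorff_outer_connected:
  assumes "connected S" "p \<in> S" "q \<in> S"
  shows "ennreal (dist p q) \<le> hausdorff_outer 1 S"
proof -
  have "ennreal (dist p q) \<le> hausdorff_pre 1 1 S"
    unfolding hausdorff_pre_def
  proof (rule INF_greatest, clarify)
    fix E :: "nat \<Rightarrow> 'a set"
    assume cov: "S \<subseteq> (\<Union>i. E i)" and E: "\<forall>i. bounded (E i) \<and> diameter (E i) \<le> 1"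
    have conn: "connected (dist p ` S)"
      by (intro connected_continuous_image continuous_intros assms)
    define a where "a i = Inf (dist p ` E i)" for i
    have sub: "dist p ` E i \<subseteq> {a i .. a i + diameter (E i)}" for i
    proof
      fix r assume r: "r \<in> dist p ` E i"
      then obtain x where x: "x \<in> E i" "r = dist p x" by auto
      have bdd: "bdd_below (dist p ` E i)" by (rule bdd_belowI[of _ 0]) auto
      have "a i \<le> r" unfolding a_def by (rule cInf_lower[OF r bdd])
      moreover have "r - diameter (E i) \<le> a i"
        unfolding a_def
      proof (rule cInf_greatest)
        fix s assume "s \<in> dist p ` E i"
        then obtain y where "y \<in> E i" "s = dist p y" by auto
        then show "r - diameter (E i) \<le> s"
          using diameter_bounded_bound[of "E i" x y] E x dist_triangle[of p x y]
          by (simp add: dist_commute)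
      qed (use r in auto)
      ultimately show "r \<in> {a i .. a i + diameter (E i)}" by auto
    qed
    have "{0..dist p q} \<subseteq> dist p ` S"
      using connected_contains_Icc[OF conn, of 0 "dist p q"] assms(2,3) by (metis dist_self imageI)
    also have "\<dots> \<subseteq> (\<Union>i. {a i .. a i + diameter (E i)})" using cov sub by fastforce
    finally have "emeasure lborel {0..dist p q} \<le> emeasure lborel (\<Union>i. {a i .. a i + diameter (E i)})"
      by (rule emeasure_mono) auto
    also have "\<dots> \<le> (\<Sum>i. emeasure lborel {a i .. a i + diameter (E i)})"
      by (rule emeasure_subadditive_countably) auto
    also have "\<dots> = (\<Sum>i. hausdorff_weight 1 (E i))"
      using E by (intro suminf_cong) (simp add: hausdorff_weight_def unit_ball_vol_1 diameter_ge_0)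
    finally show "ennreal (dist p q) \<le> (\<Sum>i. hausdorff_weight 1 (E i))" by simp
  qed
  also have "\<dots> \<le> hausdorff_outer 1 S" by (rule hausdorff_pre_le_outer) simp
  finally show ?thesis .
qed

section \<open>Multiplicity functions and their measurability\<close>

definition preimage_count :: "('a \<Rightarrow> 'b) \<Rightarrow> 'a set \<Rightarrow> 'b \<Rightarrow> ennreal" where
  "preimage_count c J x = emeasure (count_space UNIV) {t \<in> J. c t = x}"

text \<open>Keeping the parameter set as an argument allows pieces of one curve to be compared
  without reparametrization. Pieces become paths on the unit interval only where an assumption about
  paths is applied to them.\<close>

definition curve_integral :: "(real \<Rightarrow> 'a::metric_space) \<Rightarrow> real set \<Rightarrow> ('a \<Rightarrow> ennreal) \<Rightarrow> ennreal" where
  "curve_integral c J g = (\<integral>\<^sup>+x. preimage_count c J x * g x \<partial>hausdorff_measure 1)"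

lemma path_nn_integral_eq: "path_nn_integral c g = curve_integral c {0..1} g"
  by (simp add: path_nn_integral_def curve_integral_def preimage_count_def)

lemma preimage_count_mono: "J \<subseteq> J' \<Longrightarrow> preimage_count c J x \<le> preimage_count c J' x"
  unfolding preimage_count_def by (rule emeasure_mono) auto

lemma preimage_count_Un:
  "J \<inter> J' = {} \<Longrightarrow> preimage_count c (J \<union> J') x = preimage_count c J x + preimage_count c J' x"
  unfolding preimage_count_def
  by (subst plus_emeasure) (auto intro!: arg_cong[where f="emeasure (count_space UNIV)"])

lemma preimage_count_UN_incseq:
  assumes "incseq J"
  shows "preimage_count c (\<Union>n. J n) x = (SUP n. preimage_count c (J n) x)"
proof -
  have "{t \<in> (\<Union>n. J n). c t = x} = (\<Union>n. {t \<in> J n. c t = x})" by auto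
  then show ?thesis
    unfolding preimage_count_def using assms
    by (subst SUP_emeasure_incseq) (auto simp: incseq_def)
qed

lemma preimage_count_ge_1: "x \<in> c ` J \<Longrightarrow> 1 \<le> preimage_count c J x"
proof -
  assume "x \<in> c ` J"
  then obtain t where "t \<in> J" "c t = x" by auto
  then have "emeasure (count_space UNIV) {t} \<le> preimage_count c J x"
    unfolding preimage_count_def by (intro emeasure_mono) auto
  then show ?thesis by simp
qed

lemma preimage_count_eq_0: "x \<notin> c ` J \<Longrightarrow> preimage_count c J x = 0"
proof -
  assume "x \<notin> c ` J"
  then have "{t \<in> J. c t = x} = {}" by auto
  then show ?thesis unfolding preimage_count_def by (simp only: emeasure_empty)
qed

text \<open>Continuous images of Borel sets need not be Borel, but a half-open interval is a
  countable union of compact ones, so the image is a countable union of compact sets.\<close>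

lemma borel_image_closed_half_open:
  fixes c :: "real \<Rightarrow> 'a::metric_space"
  assumes "compact J" "continuous_on J c"
  shows "c ` (J \<inter> {p..<q}) \<in> sets borel"
proof -
  have "{p..<q} = (\<Union>m. {p..q - inverse (real (Suc m))})"
  proof (intro set_eqI iffI)
    fix t assume "t \<in> {p..<q}"
    then obtain m where "inverse (real (Suc m)) < q - t"
      using reals_Archimedean[of "q - t"] by auto
    then show "t \<in> (\<Union>m. {p..q - inverse (real (Suc m))})" using \<open>t \<in> {p..<q}\<close>
      by (intro UN_I[of m]) auto
  next
    fix t assume "t \<in> (\<Union>m. {p..q - inverse (real (Suc m))})"
    then obtain m where "p \<le> t" "t \<le> q - inverse (real (Suc m))" by auto
    moreover have "q - inverse (real (Suc m)) < q" by simp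
    ultimately show "t \<in> {p..<q}"
      unfolding atLeastLessThan_iff by (blast intro: le_less_trans)
  qed
  then have eq: "c ` (J \<inter> {p..<q}) = (\<Union>m. c ` (J \<inter> {p..q - inverse (real (Suc m))}))" by auto
  have "compact (c ` (J \<inter> {p..q - inverse (real (Suc m))}))" for m
    using assms by (intro compact_continuous_image compact_Int_closed) (auto intro: continuous_on_subset)
  then show ?thesis unfolding eq by (intro sets.countable_UN) (auto intro: borel_compact)
qed

text \<open>This is Banach's indicatrix argument: count the dyadic cells that contain a preimage of
  \<open>x\<close>. Disjointness of the cells gives the upper bound; any finite set of preimages is
  separated by sufficiently fine cells, which gives the lower bound also when there are infinitely
  many.\<close>

lemma preimage_count_eq_SUP:
  fixes c :: "real \<Rightarrow> 'a" and J :: "real set"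
  assumes J: "J \<subseteq> {0..1}"
  shows "preimage_count c J x =
    (SUP n. \<Sum>k\<le>2^n. indicator (c ` (J \<inter> {real k / 2^n ..< real (Suc k) / 2^n})) x)"
proof (rule antisym)
  let ?I = "\<lambda>n k. {real k / 2^n ..< real (Suc k) / 2^n}"
  \<comment> \<open>The index \<open>k = 2 ^ n\<close> is included because the cells are half-open
    and the parameter 1 lies in that cell only.\<close>
  let ?s = "\<lambda>n. \<Sum>k\<le>2^n. indicator (c ` (J \<inter> ?I n k)) x :: ennreal"
  let ?T = "{t \<in> J. c t = x}"
  have floor: "t \<in> ?I n k \<longleftrightarrow> \<lfloor>t * 2^n\<rfloor> = int k" for t :: real and n k
    by (auto simp: field_simps floor_eq_iff)
  have disj: "disjoint_family_on (?I n) A" for n A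
    unfolding disjoint_family_on_def
    by (auto simp only: floor disjoint_iff)
  have lower: "of_nat (card F) \<le> (SUP n. ?s n)" if F: "finite F" "F \<subseteq> ?T" for F
  proof -
    have "\<exists>n. \<forall>s\<in>F. \<forall>t\<in>F. s \<noteq> t \<longrightarrow> 1 / 2^n \<le> \<bar>s - t\<bar>"
    proof (cases "\<exists>s\<in>F. \<exists>t\<in>F. s \<noteq> t")
      case True
      define D where "D = (\<lambda>(s,t). \<bar>s - t\<bar>) ` {(s,t) \<in> F \<times> F. s \<noteq> t}"
      have fin: "finite D" unfolding D_def using F(1) by (auto intro: finite_subset[of _ "F \<times> F"])
      have ne: "D \<noteq> {}" using True by (auto simp: D_def)
      have pos: "d > 0" if "d \<in> D" for d using that by (auto simp: D_def)
      have "Min D > 0" using Min_in[OF fin ne] pos by blast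
      then obtain n where n: "(1/2::real)^n < Min D"
        using real_arch_pow_inv[of "Min D" "1/2"] by auto
      have "1 / 2^n \<le> d" if "d \<in> D" for d
        using order.strict_trans2[OF n Min_le[OF fin that]] by (simp add: power_one_over)
      moreover have "\<bar>s - t\<bar> \<in> D" if "s \<in> F" "t \<in> F" "s \<noteq> t" for s t
        unfolding D_def using that by (intro image_eqI[of _ _ "(s, t)"]) auto
      ultimately have "\<forall>s\<in>F. \<forall>t\<in>F. s \<noteq> t \<longrightarrow> 1 / 2^n \<le> \<bar>s - t\<bar>" by simp
      then show ?thesis by (rule exI)
    qed auto
    then obtain n where n: "\<And>s t. s \<in> F \<Longrightarrow> t \<in> F \<Longrightarrow> s \<noteq> t \<Longrightarrow> 1 / 2^n \<le> \<bar>s - t\<bar>" by auto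
    define \<kappa> where "\<kappa> t = nat \<lfloor>t * 2^n\<rfloor>" for t :: real
    have F01: "F \<subseteq> {0..1}" using F J by auto
    have \<kappa>: "t \<in> ?I n (\<kappa> t)" "\<kappa> t \<le> 2^n" if "t \<in> F" for t
    proof -
      have t: "0 \<le> t" "t \<le> 1" using that F01 by auto
      then show "t \<in> ?I n (\<kappa> t)" by (simp only: floor \<kappa>_def) simp
      have "\<lfloor>t * 2^n\<rfloor> \<le> \<lfloor>2^n::real\<rfloor>" using t by (intro floor_mono) (simp add: mult_left_le_one_le)
      also have "\<lfloor>2^n::real\<rfloor> = 2^n" by (metis floor_of_int of_int_numeral of_int_power)
      finally show "\<kappa> t \<le> 2^n" by (simp add: \<kappa>_def nat_le_iff)
    qed
    have inj: "inj_on \<kappa> F"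
    proof (rule inj_onI, rule ccontr)
      fix s t assume st: "s \<in> F" "t \<in> F" "\<kappa> s = \<kappa> t" "s \<noteq> t"
      have "s \<in> ?I n (\<kappa> t)" "t \<in> ?I n (\<kappa> t)" using \<kappa> st by metis+
      then have "\<bar>s - t\<bar> < 1 / 2^n" by (auto simp: field_simps abs_if)
      then show False using n[of s t] st by auto
    qed
    have "of_nat (card F) = (of_nat (card (\<kappa> ` F)) :: ennreal)" using card_image[OF inj] by simp
    also have "\<dots> = (\<Sum>k\<in>\<kappa> ` F. 1)" by simp
    also have "\<dots> \<le> (\<Sum>k\<in>\<kappa> ` F. indicator (c ` (J \<inter> ?I n k)) x)"
    proof (intro sum_mono)
      fix k assume "k \<in> \<kappa> ` F"
      then obtain t where t: "t \<in> F" "k = \<kappa> t" by auto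
      then have "x \<in> c ` (J \<inter> ?I n k)" using F(2) \<kappa>(1)[of t] by (intro image_eqI[of _ _ t]) auto
      then show "1 \<le> (indicator (c ` (J \<inter> ?I n k)) x :: ennreal)" by simp
    qed
    also have "\<dots> \<le> ?s n" using \<kappa>(2) F(1) by (intro sum_mono2) auto
    also have "\<dots> \<le> (SUP n. ?s n)" by (rule SUP_upper) simp
    finally show ?thesis .
  qed
  show "preimage_count c J x \<le> (SUP n. ?s n)"
  proof (cases "finite ?T")
    case True
    then show ?thesis using lower[of ?T] by (simp add: preimage_count_def)
  next
    case False
    have "of_nat k \<le> (SUP n. ?s n)" for k
    proof -
      obtain F where "F \<subseteq> ?T" "finite F" "card F = k"
        using infinite_arbitrarily_large[OF False] by blast
      then show ?thesis using lower[of F] by simp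
    qed
    then have "(SUP k. of_nat k) \<le> (SUP n. ?s n)" by (rule SUP_least)
    then show ?thesis unfolding ennreal_SUP_of_nat_eq_top top_unique by (simp only: top_greatest)
  qed
  show "(SUP n. ?s n) \<le> preimage_count c J x"
  proof (rule SUP_least)
    fix n
    have "?s n \<le> (\<Sum>k\<le>2^n. emeasure (count_space UNIV) (?T \<inter> ?I n k))"
    proof (intro sum_mono)
      fix k
      have "1 \<le> emeasure (count_space UNIV) (?T \<inter> ?I n k)" if *: "x \<in> c ` (J \<inter> ?I n k)"
      proof -
        obtain t where "t \<in> ?T \<inter> ?I n k" using * by auto
        then have "emeasure (count_space UNIV) {t} \<le> emeasure (count_space UNIV) (?T \<inter> ?I n k)"
          by (intro emeasure_mono) auto
        then show ?thesis by simp
      qed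
      then show "indicator (c ` (J \<inter> ?I n k)) x \<le> emeasure (count_space UNIV) (?T \<inter> ?I n k)"
        by (auto simp: indicator_def)
    qed
    also have "\<dots> = emeasure (count_space UNIV) (\<Union>k\<le>2^n. ?T \<inter> ?I n k)"
    proof (rule sum_emeasure)
      show "disjoint_family_on (\<lambda>k. ?T \<inter> ?I n k) {..2^n}"
        using disj[of n "{..2^n}"] unfolding disjoint_family_on_def by blast
    qed auto
    also have "\<dots> \<le> preimage_count c J x"
      unfolding preimage_count_def by (intro emeasure_mono) auto
    finally show "?s n \<le> preimage_count c J x" .
  qed
qed

lemma borel_measurable_preimage_count:
  fixes c :: "real \<Rightarrow> 'a::metric_space"
  assumes "compact J" "J \<subseteq> {0..1}" "continuous_on J c"
  shows "preimage_count c J \<in> borel_measurable borel"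
proof -
  have [measurable]: "c ` (J \<inter> {p..<q}) \<in> sets borel" for p q
    by (rule borel_image_closed_half_open) fact+
  show ?thesis
    by (subst preimage_count_eq_SUP[OF assms(2), abs_def]) measurable
qed

lemma AE_hausdorff_measure_neq: "m > 0 \<Longrightarrow> AE x in hausdorff_measure m. x \<noteq> p"
  by (intro AE_I[where N="{p}"]) (auto simp: emeasure_hausdorff_measure_singleton)

lemma borel_measurable_preimage_count_Icc:
  fixes c :: "real \<Rightarrow> 'a::metric_space"
  assumes "path c" "0 \<le> s" "t \<le> 1"
  shows "preimage_count c {s..t} \<in> borel_measurable borel"
  using assms by (intro borel_measurable_preimage_count) (auto simp: path_def intro: continuous_on_subset)

lemma curve_integral_mono_set: "J \<subseteq> J' \<Longrightarrow> curve_integral c J g \<le> curve_integral c J' g"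
  unfolding curve_integral_def by (intro nn_integral_mono mult_right_mono preimage_count_mono) auto

lemma curve_integral_mono:
  "(\<And>x. x \<in> c ` J \<Longrightarrow> g x \<le> h x) \<Longrightarrow> curve_integral c J g \<le> curve_integral c J h"
  unfolding curve_integral_def
proof (intro nn_integral_mono)
  fix x assume "\<And>x. x \<in> c ` J \<Longrightarrow> g x \<le> h x"
  then show "preimage_count c J x * g x \<le> preimage_count c J x * h x"
    by (cases "x \<in> c ` J") (simp_all add: preimage_count_eq_0 mult_left_mono)
qed

lemma curve_integral_cmult:
  assumes "path c" "0 \<le> s" "t \<le> 1" "g \<in> borel_measurable borel"
  shows "curve_integral c {s..t} (\<lambda>x. k * g x) = k * curve_integral c {s..t} g"
proof -
  note [measurable] = borel_measurable_preimage_count_Icc[OF assms(1-3)] assms(4)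
  show ?thesis
    unfolding curve_integral_def by (subst nn_integral_cmult[symmetric]) (auto simp: ac_simps)
qed

lemma curve_integral_add:
  assumes "path c" "0 \<le> s" "t \<le> 1" "g \<in> borel_measurable borel" "h \<in> borel_measurable borel"
  shows "curve_integral c {s..t} (\<lambda>x. g x + h x) = curve_integral c {s..t} g + curve_integral c {s..t} h"
proof -
  note [measurable] = borel_measurable_preimage_count_Icc[OF assms(1-3)] assms(4,5)
  show ?thesis
    unfolding curve_integral_def by (subst nn_integral_add[symmetric]) (auto simp: distrib_left)
qed

lemma curve_integral_suminf:
  assumes "path c" "0 \<le> s" "t \<le> 1" "\<And>i. g i \<in> borel_measurable borel"
  shows "curve_integral c {s..t} (\<lambda>x. \<Sum>i. g i x) = (\<Sum>i. curve_integral c {s..t} (g i))"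
proof -
  note [measurable] = borel_measurable_preimage_count_Icc[OF assms(1-3)] assms(4)
  show ?thesis
    unfolding curve_integral_def by (subst nn_integral_suminf[symmetric]) auto
qed

text \<open>The library constant \<^const>\<open>subpath\<close> is restricted to paths in normed spaces.\<close>

definition path_piece :: "real \<Rightarrow> real \<Rightarrow> (real \<Rightarrow> 'a) \<Rightarrow> real \<Rightarrow> 'a" where
  "path_piece s t c = (\<lambda>r. c ((t - s) * r + s))"

lemma affine_image_Icc_0_1: "s < t \<Longrightarrow> (\<lambda>r. (t - s) * r + s) ` {0..1} = {s..t::real}"
  using image_affinity_atLeastAtMost[of "t - s" s 0 1] by (simp add: ac_simps)

lemma path_path_piece:
  assumes "path c" "0 \<le> s" "s < t" "t \<le> 1"
  shows "path (path_piece s t c)"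
proof -
  have "continuous_on ((\<lambda>r. (t - s) * r + s) ` {0..1}) c"
    using assms unfolding affine_image_Icc_0_1[OF assms(3)] path_def
    by (auto intro: continuous_on_subset)
  then have "continuous_on {0..1} (c \<circ> (\<lambda>r. (t - s) * r + s))"
    by (intro continuous_on_compose continuous_intros)
  then show ?thesis by (simp add: path_def path_piece_def o_def)
qed

lemma path_image_path_piece: "s < t \<Longrightarrow> path_image (path_piece s t c) = c ` {s..t}"
  unfolding path_image_def path_piece_def affine_image_Icc_0_1[symmetric] by (simp add: image_image)

lemma pathstart_path_piece [simp]: "pathstart (path_piece s t c) = c s"
  and pathfinish_path_piece [simp]: "pathfinish (path_piece s t c) = c t"
  by (simp_all add: pathstart_def pathfinish_def path_piece_def)

lemma path_nn_integral_path_piece: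
  assumes "s < t"
  shows "path_nn_integral (path_piece s t c) g = curve_integral c {s..t} g"
proof -
  have "emeasure (count_space UNIV) {r \<in> {0..1}. path_piece s t c r = x} = preimage_count c {s..t} x" for x
  proof -
    let ?\<phi> = "\<lambda>r. (t - s) * r + s"
    have inj: "inj_on ?\<phi> A" for A using assms by (auto simp: inj_on_def)
    have "{r \<in> {s..t}. c r = x} = ?\<phi> ` {r \<in> {0..1}. path_piece s t c r = x}"
      unfolding affine_image_Icc_0_1[OF assms, symmetric] by (auto simp: path_piece_def)
    then show ?thesis
      unfolding preimage_count_def using inj
      by (simp add: emeasure_count_space finite_image_iff card_image)
  qed
  then show ?thesis by (simp add: path_nn_integral_def curve_integral_def)
qed

section \<open>Additivity and continuity of the integral in the parameter interval\<close>

lemma curve_integral_Icc_combine: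
  fixes c :: "real \<Rightarrow> 'a::metric_space"
  assumes c: "path c" and r: "0 \<le> r" "r \<le> s" "s \<le> t" "t \<le> 1" and g: "g \<in> borel_measurable borel"
  shows "curve_integral c {r..s} g + curve_integral c {s..t} g = curve_integral c {r..t} g"
proof -
  have [measurable]: "preimage_count c {r..s} \<in> borel_measurable borel"
    "preimage_count c {s..t} \<in> borel_measurable borel"
    using c r by (auto intro!: borel_measurable_preimage_count_Icc)
  note [measurable] = g
  \<comment> \<open>The common parameter \<open>s\<close> is counted twice on the right, which
    affects only the value at \<open>c s\<close>, a null set for
    \<open>hausdorff_measure 1\<close>.\<close>
  have eq: "preimage_count c {r..t} x = preimage_count c {r..s} x + preimage_count c {s..t} x"
    if "x \<noteq> c s" for x
  proof -
    have "{u \<in> {s..t}. c u = x} = {u \<in> {s<..t}. c u = x}"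
      using that by (auto simp: less_le)
    then have "preimage_count c {s..t} x = preimage_count c {s<..t} x"
      by (simp only: preimage_count_def)
    moreover have "{r..t} = {r..s} \<union> {s<..t}" using r by auto
    ultimately show ?thesis
      by (simp add: preimage_count_Un ivl_disj_int)
  qed
  have "curve_integral c {r..t} g =
    (\<integral>\<^sup>+x. preimage_count c {r..s} x * g x + preimage_count c {s..t} x * g x \<partial>hausdorff_measure 1)"
    unfolding curve_integral_def
  proof (rule nn_integral_cong_AE)
    have "AE x in hausdorff_measure 1. x \<noteq> c s" by (rule AE_hausdorff_measure_neq) simp
    then show "AE x in hausdorff_measure 1. preimage_count c {r..t} x * g x =
        preimage_count c {r..s} x * g x + preimage_count c {s..t} x * g x"
      by eventually_elim (simp add: eq distrib_right)
  qed
  also have "\<dots> = curve_integral c {r..s} g + curve_integral c {s..t} g"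
    unfolding curve_integral_def by (intro nn_integral_add) auto
  finally show ?thesis by simp
qed

lemma curve_integral_singleton:
  fixes c :: "real \<Rightarrow> 'a::metric_space"
  shows "curve_integral c {p} g = 0"
proof -
  have "AE x in hausdorff_measure 1. preimage_count c {p} x * g x = 0"
  proof -
    have "AE x in hausdorff_measure 1. x \<noteq> c p" by (rule AE_hausdorff_measure_neq) simp
    then show ?thesis by eventually_elim (auto simp: preimage_count_eq_0)
  qed
  then have "curve_integral c {p} g = (\<integral>\<^sup>+x. 0 \<partial>(hausdorff_measure 1 :: 'a measure))"
    unfolding curve_integral_def by (rule nn_integral_cong_AE)
  then show ?thesis by simp
qed

text \<open>Monotone convergence for the multiplicities. The parameter \<open>p\<close> missed by
  the intervals affects only the point \<open>c p\<close>, which is null; this is what allows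
  intervals to shrink away from an endpoint.\<close>

lemma curve_integral_SUP:
  fixes c :: "real \<Rightarrow> 'a::metric_space"
  assumes c: "path c" and g: "g \<in> borel_measurable borel"
    and J: "incseq (\<lambda>n. {a n..b n})" "\<And>n. 0 \<le> a n" "\<And>n. b n \<le> 1"
    and cov: "J \<subseteq> insert p (\<Union>n. {a n..b n})"
  shows "curve_integral c J g \<le> (SUP n. curve_integral c {a n..b n} g)"
proof -
  have [measurable]: "preimage_count c {a n..b n} \<in> borel_measurable borel" for n
    using c J by (auto intro!: borel_measurable_preimage_count_Icc)
  note [measurable] = g
  have "preimage_count c J x \<le> (SUP n. preimage_count c {a n..b n} x)" if "x \<noteq> c p" for x
  proof -
    have "{u \<in> J. c u = x} \<subseteq> {u \<in> (\<Union>n. {a n..b n}). c u = x}" using cov that by blast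
    then have "preimage_count c J x \<le> preimage_count c (\<Union>n. {a n..b n}) x"
      unfolding preimage_count_def by (intro emeasure_mono) auto
    then show ?thesis by (simp only: preimage_count_UN_incseq[OF J(1)])
  qed
  then have *: "preimage_count c J x * g x \<le> (SUP n. preimage_count c {a n..b n} x * g x)"
    if "x \<noteq> c p" for x
    using that by (simp add: SUP_mult_right_ennreal[symmetric] mult_right_mono)
  have "curve_integral c J g
      \<le> (\<integral>\<^sup>+x. (SUP n. preimage_count c {a n..b n} x * g x) \<partial>hausdorff_measure 1)"
    unfolding curve_integral_def
  proof (rule nn_integral_mono_AE)
    have "AE x in hausdorff_measure 1. x \<noteq> c p" by (rule AE_hausdorff_measure_neq) simp
    then show "AE x in hausdorff_measure 1. preimage_count c J x * g x
        \<le> (SUP n. preimage_count c {a n..b n} x * g x)"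
      by eventually_elim (rule *)
  qed
  also have "\<dots> = (SUP n. curve_integral c {a n..b n} g)"
    unfolding curve_integral_def
  proof (rule nn_integral_monotone_convergence_SUP)
    show "incseq (\<lambda>n x. preimage_count c {a n..b n} x * g x)"
      by (intro monoI le_funI mult_right_mono preimage_count_mono incseqD[OF J(1)]) auto
  qed auto
  finally show ?thesis .
qed

text \<open>Shortening \<open>{0..s}\<close> and \<open>{s..1}\<close> slightly near
  \<open>s\<close> changes either integral by less than \<open>e'\<close>. The first estimate
  prevents the integral up to \<open>t\<close> from falling far below its value at \<open>s\<close>,
  the second from rising far above it. Continuity is what makes cuts at prescribed values of the
  integral possible.\<close>

lemma curve_integral_continuous_endpoint:
  fixes c :: "real \<Rightarrow> 'a::metric_space"
  assumes c: "path c" and g: "g \<in> borel_measurable borel"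
    and fin: "curve_integral c {0..1} g < \<infinity>"
  shows "continuous_on {0..1} (\<lambda>t. enn2real (curve_integral c {0..t} g))"
  unfolding continuous_on_iff
proof (intro ballI allI impI)
  fix s :: real and e :: real assume s: "s \<in> {0..1}" and "0 < e"
  define e' where "e' = e / 2"
  have e': "e' > 0" "e' < e" using \<open>0 < e\<close> by (auto simp: e'_def)
  let ?F = "\<lambda>t. curve_integral c {0..t} g" and ?G = "\<lambda>t. curve_integral c {t..1} g"
  have finF: "curve_integral c J g \<noteq> \<infinity>" if "J \<subseteq> {0..1}" for J
    using curve_integral_mono_set[OF that, of c g] fin by (auto simp: top_unique)
  have "?F s \<le> (SUP n. curve_integral c {0..s - inverse (real (Suc n))} g)"
  proof (rule curve_integral_SUP[OF c g])
    show "incseq (\<lambda>n. {0..s - inverse (real (Suc n))})"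
      by (auto simp: incseq_def field_simps intro: order_trans)
    show "{0..s} \<subseteq> insert s (\<Union>n. {0..s - inverse (real (Suc n))})"
    proof
      fix t assume t: "t \<in> {0..s}"
      show "t \<in> insert s (\<Union>n. {0..s - inverse (real (Suc n))})"
      proof (cases "t = s")
        case False
        then obtain n where "inverse (real (Suc n)) < s - t"
          using reals_Archimedean[of "s - t"] t by auto
        then show ?thesis using t by (intro insertI2 UN_I[of n]) auto
      qed simp
    qed
    show "s - inverse (real (Suc n)) \<le> 1" for n
    proof -
      have "0 \<le> inverse (real (Suc n))" by simp
      then show ?thesis using s unfolding atLeastAtMost_iff by linarith
    qed
  qed simp
  then have F: "?F s = (SUP n. curve_integral c {0..s - inverse (real (Suc n))} g)"
    by (intro antisym SUP_least curve_integral_mono_set) auto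
  obtain n where n: "?F s < curve_integral c {0..s - inverse (real (Suc n))} g + ennreal e'"
    using SUP_approx_ennreal[OF e'(1) UNIV_not_empty F] finF[of "{0..s}"] s by auto
  have "?G s \<le> (SUP n. curve_integral c {s + inverse (real (Suc n))..1} g)"
  proof (rule curve_integral_SUP[OF c g])
    show "incseq (\<lambda>n. {s + inverse (real (Suc n))..1})"
      unfolding incseq_def using le_imp_inverse_le by (auto intro: order_trans[rotated])
    show "{s..1} \<subseteq> insert s (\<Union>n. {s + inverse (real (Suc n))..1})"
    proof
      fix t assume t: "t \<in> {s..1}"
      show "t \<in> insert s (\<Union>n. {s + inverse (real (Suc n))..1})"
      proof (cases "t = s")
        case False
        then obtain n where "inverse (real (Suc n)) < t - s"
          using reals_Archimedean[of "t - s"] t by auto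
        then show ?thesis using t by (intro insertI2 UN_I[of n]) auto
      qed simp
    qed
    show "0 \<le> s + inverse (real (Suc n))" for n using s by simp
  qed simp
  then have G: "?G s = (SUP n. curve_integral c {s + inverse (real (Suc n))..1} g)"
    by (intro antisym SUP_least curve_integral_mono_set) auto
  obtain m where m: "?G s < curve_integral c {s + inverse (real (Suc m))..1} g + ennreal e'"
    using SUP_approx_ennreal[OF e'(1) UNIV_not_empty G] finF[of "{s..1}"] s by auto
  define d where "d = min (inverse (real (Suc n))) (inverse (real (Suc m)))"
  have close: "dist (enn2real (?F t)) (enn2real (?F s)) < e" if t: "t \<in> {0..1}" "dist t s < d" for t
  proof -
    have left: "?F s \<le> ?F t + ennreal e'"
    proof -
      have "?F s \<le> curve_integral c {0..s - inverse (real (Suc n))} g + ennreal e'" using n by simp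
      also have "\<dots> \<le> ?F t + ennreal e'"
        using t by (intro add_right_mono curve_integral_mono_set) (auto simp: d_def dist_real_def)
      finally show ?thesis .
    qed
    \<comment> \<open>The approximation of \<open>?G s\<close> bounds the loss in the remaining
      integral; additivity turns this into a bound on the gain of \<open>?F\<close>, and finiteness
      permits the cancellation.\<close>
    have right: "?F t \<le> ?F s + ennreal e'"
    proof -
      have "?G s \<le> curve_integral c {s + inverse (real (Suc m))..1} g + ennreal e'" using m by simp
      also have "\<dots> \<le> ?G t + ennreal e'"
        using t by (intro add_right_mono curve_integral_mono_set) (auto simp: d_def dist_real_def)
      finally have "?F s + ?G s \<le> ?F s + (?G t + ennreal e')" by (rule add_left_mono)
      moreover have "?F s + ?G s = ?F t + ?G t"
        using s t by (simp add: curve_integral_Icc_combine[OF c _ _ _ _ g])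
      ultimately have "?G t + ?F t \<le> ?G t + (?F s + ennreal e')" by (simp add: ac_simps)
      then show ?thesis
        using finF[of "{t..1}"] t by (auto simp: ennreal_add_left_cancel_le)
    qed
    have "?F t = ennreal (enn2real (?F t))" "?F s = ennreal (enn2real (?F s))"
      using finF[of "{0..t}"] finF[of "{0..s}"] s t by (auto simp: less_top)
    then have "enn2real (?F s) \<le> enn2real (?F t) + e'" "enn2real (?F t) \<le> enn2real (?F s) + e'"
      using left right e'
      by (metis enn2real_nonneg ennreal_le_iff ennreal_plus less_imp_le add_nonneg_nonneg)+
    then show ?thesis using e' by (simp add: dist_real_def)
  qed
  show "\<exists>d>0. \<forall>t\<in>{0..1}. dist t s < d \<longrightarrow> dist (enn2real (?F t)) (enn2real (?F s)) < e"
    using close by (intro exI[of _ d]) (auto simp: d_def)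
qed

text \<open>
  Cut \<open>c\<close> into as many pieces of \<open>\<sigma>\<close>-length \<open>\<epsilon>\<close> as possible; less than \<open>\<epsilon>\<close> is left over.
\<close>

lemma curve_integral_le_chop:
  fixes c :: "real \<Rightarrow> 'a::metric_space" and c' :: "real \<Rightarrow> 'b::metric_space"
  assumes c: "path c" and \<sigma>: "\<sigma> \<in> borel_measurable borel"
    and c': "path c'" and g: "g \<in> borel_measurable borel"
    and fin: "curve_integral c {0..1} \<sigma> < \<infinity>" and \<epsilon>: "\<epsilon> > 0"
    and unit: "\<And>s t. 0 \<le> s \<Longrightarrow> s < t \<Longrightarrow> t \<le> 1 \<Longrightarrow> ennreal \<epsilon> \<le> curve_integral c {s..t} \<sigma> \<Longrightarrow>
      1 \<le> curve_integral c' {s..t} g"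
  shows "curve_integral c {0..1} \<sigma> \<le> ennreal \<epsilon> * curve_integral c' {0..1} g + ennreal \<epsilon>"
proof -
  define F where "F t = enn2real (curve_integral c {0..t} \<sigma>)" for t
  have F: "curve_integral c {0..t} \<sigma> = ennreal (F t)" if "t \<le> 1" for t
  proof -
    have "curve_integral c {0..t} \<sigma> \<le> curve_integral c {0..1} \<sigma>"
      using that by (intro curve_integral_mono_set) auto
    then have "curve_integral c {0..t} \<sigma> < top" using fin by (simp add: le_less_trans)
    then show ?thesis by (simp add: F_def)
  qed
  have contF: "continuous_on {0..1} F"
    unfolding F_def by (rule curve_integral_continuous_endpoint) fact+
  have F0: "F 0 = 0" by (simp add: F_def curve_integral_singleton)
  \<comment> \<open>The intermediate value theorem supplies the k-th cut, and by \<open>unit\<close>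
    each piece between consecutive cuts contributes at least 1 to the integral of
    \<open>g\<close>.\<close>
  have ex: "\<exists>t\<in>{0..1}. F t = real k * \<epsilon> \<and> of_nat k \<le> curve_integral c' {0..t} g"
    if "real k * \<epsilon> \<le> F 1" for k
    using that
  proof (induction k)
    case 0
    then show ?case using F0 by (intro bexI[of _ 0]) auto
  next
    case (Suc k)
    then obtain t where t: "t \<in> {0..1}" "F t = real k * \<epsilon>" "of_nat k \<le> curve_integral c' {0..t} g"
      using \<epsilon> by (auto simp: distrib_right)
    obtain t' where t': "t \<le> t'" "t' \<le> 1" "F t' = real (Suc k) * \<epsilon>"
      using IVT'[of F t "real (Suc k) * \<epsilon>" 1] Suc.prems t \<epsilon> continuous_on_subset[OF contF, of "{t..1}"]
      by (auto simp: distrib_right)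
    have "t < t'" using t t' \<epsilon> by (cases "t = t'") (auto simp: distrib_right)
    have "ennreal (F t) + curve_integral c {t..t'} \<sigma> = ennreal (F t')"
      using curve_integral_Icc_combine[OF c _ _ _ _ \<sigma>, of 0 t t'] t t' by (simp add: F)
    also have "F t' = F t + \<epsilon>" using t t' by (simp add: distrib_right)
    also have "ennreal (F t + \<epsilon>) = ennreal (F t) + ennreal \<epsilon>"
      using \<epsilon> by (intro ennreal_plus) (auto simp: F_def)
    finally have "ennreal \<epsilon> \<le> curve_integral c {t..t'} \<sigma>"
      by (auto simp: ennreal_add_left_cancel)
    then have "1 \<le> curve_integral c' {t..t'} g" using unit[of t t'] t t' \<open>t < t'\<close> by auto
    then have "of_nat k + 1 \<le> curve_integral c' {0..t} g + curve_integral c' {t..t'} g"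
      using t by (intro add_mono)
    also have "\<dots> = curve_integral c' {0..t'} g"
      using curve_integral_Icc_combine[OF c' _ _ _ _ g, of 0 t t'] t t' by simp
    finally show ?case using t t' by (intro bexI[of _ t']) (auto simp: add.commute)
  qed
  define N where "N = nat \<lfloor>F 1 / \<epsilon>\<rfloor>"
  have "F 1 / \<epsilon> \<ge> 0" using \<epsilon> by (simp add: F_def)
  then have N: "real N \<le> F 1 / \<epsilon>" "F 1 / \<epsilon> < real N + 1" by (simp_all add: N_def)
  then obtain t where t: "t \<in> {0..1}" "of_nat N \<le> curve_integral c' {0..t} g"
    using ex[of N] \<epsilon> by (auto simp: pos_le_divide_eq)
  have "curve_integral c {0..1} \<sigma> = ennreal (F 1)" by (simp add: F)
  also have "\<dots> \<le> ennreal (\<epsilon> * real N + \<epsilon>)"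
    using N \<epsilon> by (intro ennreal_leI) (simp add: pos_divide_less_eq algebra_simps)
  also have "\<dots> = ennreal \<epsilon> * of_nat N + ennreal \<epsilon>"
    using \<epsilon> by (simp add: ennreal_mult ennreal_of_nat_eq_real_of_nat)
  also have "\<dots> \<le> ennreal \<epsilon> * curve_integral c' {0..1} g + ennreal \<epsilon>"
    using t order_trans[OF t(2) curve_integral_mono_set, of "{0..1}"]
    by (intro add_right_mono mult_left_mono) auto
  finally show ?thesis .
qed

section \<open>Length of curves\<close>

lemma hausdorff_outer_image_le_curve_integral:
  fixes c :: "real \<Rightarrow> 'a::metric_space"
  assumes "path c" "0 \<le> s" "t \<le> 1"
  shows "hausdorff_outer 1 (c ` {s..t}) \<le> curve_integral c {s..t} (\<lambda>_. 1)"
proof -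
  have "compact (c ` {s..t})"
    using assms by (intro compact_continuous_image) (auto simp: path_def intro: continuous_on_subset)
  then have b: "c ` {s..t} \<in> sets borel" by (rule borel_compact)
  then have "hausdorff_outer 1 (c ` {s..t}) = (\<integral>\<^sup>+x. indicator (c ` {s..t}) x \<partial>hausdorff_measure 1)"
    by (simp add: emeasure_hausdorff_measure)
  also have "\<dots> \<le> curve_integral c {s..t} (\<lambda>_. 1)"
    unfolding curve_integral_def
    by (intro nn_integral_mono) (auto simp: indicator_def intro!: preimage_count_ge_1)
  finally show ?thesis .
qed

text \<open>Each chord is at most the Hausdorff measure of the connected arc between its endpoints,
  and the integrals over consecutive intervals add up. Finiteness of an integral thereby yields
  rectifiability, which is needed before an upper gradient can be applied to an image path.\<close>

lemma path_length_le_curve_integral: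
  fixes c :: "real \<Rightarrow> 'a::metric_space"
  assumes c: "path c"
  shows "path_length c \<le> curve_integral c {0..1} (\<lambda>_. 1)"
proof -
  have "(\<Sum>i<n. ennreal (dist (c (t i)) (c (t (Suc i))))) \<le> curve_integral c {0..1} (\<lambda>_. 1)"
    if mono: "mono_on {..n} t" and "t ` {..n} \<subseteq> {0..1}" for n :: nat and t :: "nat \<Rightarrow> real"
  proof -
  have t01: "0 \<le> t i" "t i \<le> 1" if "i \<le> n" for i using \<open>t ` {..n} \<subseteq> {0..1}\<close> that by auto
  have "(\<Sum>i<k. ennreal (dist (c (t i)) (c (t (Suc i))))) \<le> curve_integral c {t 0..t k} (\<lambda>_. 1)"
    if "k \<le> n" for k
    using that
  proof (induction k)
    case (Suc k)
    have le: "t 0 \<le> t k" "t k \<le> t (Suc k)" using mono Suc.prems by (auto intro: mono_onD)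
    have "ennreal (dist (c (t k)) (c (t (Suc k)))) \<le> hausdorff_outer 1 (c ` {t k..t (Suc k)})"
      using c t01[of k] t01[of "Suc k"] Suc.prems le
      by (intro dist_le_hausdorff_outer_connected connected_continuous_image)
        (auto simp: path_def intro: continuous_on_subset)
    also have "\<dots> \<le> curve_integral c {t k..t (Suc k)} (\<lambda>_. 1)"
      using c t01 Suc.prems by (intro hausdorff_outer_image_le_curve_integral) auto
    finally have "(\<Sum>i<Suc k. ennreal (dist (c (t i)) (c (t (Suc i)))))
        \<le> curve_integral c {t 0..t k} (\<lambda>_. 1) + curve_integral c {t k..t (Suc k)} (\<lambda>_. 1)"
      using Suc by (simp add: add_mono)
    also have "\<dots> = curve_integral c {t 0..t (Suc k)} (\<lambda>_. 1)"
      using c t01 Suc.prems le by (intro curve_integral_Icc_combine) auto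
    finally show ?case .
  qed simp
  from this[of n] have "(\<Sum>i<n. ennreal (dist (c (t i)) (c (t (Suc i))))) \<le> curve_integral c {t 0..t n} (\<lambda>_. 1)"
    by simp
  also have "\<dots> \<le> curve_integral c {0..1} (\<lambda>_. 1)"
    using t01 by (intro curve_integral_mono_set) auto
  finally show ?thesis .
  qed
  then show ?thesis unfolding path_length_def by (intro SUP_least) auto
qed

section \<open>Weak monotonicity\<close>

lemma metric_surface_locally_compact:
  fixes x :: "'a::metric_space"
  assumes "metric_surface TYPE('a)"
  shows "\<exists>e>0. compact (cball x e)"
proof -
  obtain U and V :: "(real^2) set" where U: "open U" "x \<in> U" and V: "open V" "U homeomorphic V"
    using assms unfolding metric_surface_def by blast
  obtain \<phi> \<psi> where h: "homeomorphism V U \<phi> \<psi>"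
    using V(2) homeomorphic_sym unfolding homeomorphic_def by blast
  have \<psi>x: "\<psi> x \<in> V" using h U by (auto simp: homeomorphism_def)
  then obtain r where r: "r > 0" "cball (\<psi> x) r \<subseteq> V" using V(1) by (auto simp: open_contains_cball)
  have comp: "compact (\<phi> ` cball (\<psi> x) r)"
    using h r by (intro compact_continuous_image) (auto simp: homeomorphism_def intro: continuous_on_subset)
  have "openin (top_of_set U) (\<phi> ` ball (\<psi> x) r)"
    using h r by (intro homeomorphism_imp_open_map[OF h] open_subset order_trans[OF ball_subset_cball]) auto
  then have "open (\<phi> ` ball (\<psi> x) r)" using U(1) by (simp add: openin_open_eq)
  moreover have "x \<in> \<phi> ` ball (\<psi> x) r"
    using h U r(1) by (intro image_eqI[of _ _ "\<psi> x"]) (auto simp: homeomorphism_def)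
  ultimately obtain e where e: "e > 0" "cball x e \<subseteq> \<phi> ` ball (\<psi> x) r"
    by (auto simp: open_contains_cball)
  have "cball x e \<subseteq> \<phi> ` cball (\<psi> x) r"
    using e(2) by (meson ball_subset_cball image_mono order_trans)
  then have "compact (cball x e)"
    using compact_Int_closed[OF comp closed_cball] by (metis inf.absorb2)
  then show ?thesis using e(1) by blast
qed

lemma metric_surface_connected_neighbourhood:
  fixes x :: "'a::metric_space"
  assumes "metric_surface TYPE('a)" "open W" "x \<in> W"
  shows "\<exists>N. open N \<and> connected N \<and> x \<in> N \<and> N \<subseteq> W"
proof -
  obtain U and V :: "(real^2) set" where U: "open U" "x \<in> U" and V: "open V" "U homeomorphic V"
    using assms unfolding metric_surface_def by blast
  obtain \<phi> \<psi> where h: "homeomorphism V U \<phi> \<psi>"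
    using V(2) homeomorphic_sym unfolding homeomorphic_def by blast
  have \<psi>x: "\<psi> x \<in> V" "\<phi> (\<psi> x) = x" using h U by (auto simp: homeomorphism_def)
  have cont: "continuous_on V \<phi>" using h by (simp add: homeomorphism_def)
  have "open (\<phi> -` W \<inter> V)"
    using continuous_on_open_vimage[OF V(1), of \<phi>] cont assms(2) by blast
  then obtain r where r: "r > 0" "ball (\<psi> x) r \<subseteq> \<phi> -` W \<inter> V"
    using \<psi>x assms(3) open_contains_ball by (metis IntI vimage_eq)
  have "openin (top_of_set U) (\<phi> ` ball (\<psi> x) r)"
    using r by (intro homeomorphism_imp_open_map[OF h] open_subset) auto
  then have "open (\<phi> ` ball (\<psi> x) r)" using U(1) by (simp add: openin_open_eq)
  moreover have "connected (\<phi> ` ball (\<psi> x) r)"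
    using r by (intro connected_continuous_image continuous_on_subset[OF cont]) auto
  moreover have "x \<in> \<phi> ` ball (\<psi> x) r"
    using \<psi>x r(1) by (intro image_eqI[of _ _ "\<psi> x"]) auto
  moreover have "\<phi> ` ball (\<psi> x) r \<subseteq> W" using r(2) by auto
  ultimately show ?thesis by blast
qed

lemma metric_surface_open_component:
  fixes x :: "'a::metric_space"
  assumes "metric_surface TYPE('a)"
  shows "open (connected_component_set UNIV x)"
proof (subst open_subopen, intro ballI)
  fix y assume y: "y \<in> connected_component_set UNIV x"
  obtain N where N: "open N" "connected N" "y \<in> N"
    using metric_surface_connected_neighbourhood[OF assms open_UNIV UNIV_I] by blast
  have "N \<subseteq> connected_component_set UNIV y"
    using N by (intro connected_component_maximal) auto
  also have "\<dots> = connected_component_set UNIV x" using y by (metis connected_component_eq)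
  finally show "\<exists>T. open T \<and> y \<in> T \<and> T \<subseteq> connected_component_set UNIV x" using N by blast
qed

lemma compact_contained_in_relatively_compact_open:
  fixes C :: "'a::metric_space set"
  assumes "\<And>x::'a. \<exists>e>0. compact (cball x e)" and C: "compact C"
  shows "\<exists>W. open W \<and> C \<subseteq> W \<and> compact (closure W)"
proof -
  obtain e where e: "\<And>x::'a. e x > 0" "\<And>x::'a. compact (cball x (e x))" using assms(1) by metis
  obtain D where D: "D \<subseteq> C" "finite D" "C \<subseteq> (\<Union>x\<in>D. ball x (e x))"
    by (rule compactE_image[OF C, of C "\<lambda>x. ball x (e x)"]) (use e(1) in auto)
  have "compact (\<Union>x\<in>D. cball x (e x))" using D(2) e(2) by (intro compact_UN) auto
  moreover have "closure (\<Union>x\<in>D. ball x (e x)) \<subseteq> (\<Union>x\<in>D. cball x (e x))"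
    using calculation by (intro closure_minimal compact_imp_closed) auto
  ultimately have "compact (closure (\<Union>x\<in>D. ball x (e x)))"
    using compact_Int_closed[OF _ closed_closure] by (metis inf.absorb2)
  then show ?thesis using D(3) by (intro exI[of _ "\<Union>x\<in>D. ball x (e x)"]) auto
qed

section \<open>Uniform limits of homeomorphisms\<close>

lemma uniform_limit_homeomorphisms_continuous:
  fixes f :: "'a::metric_space \<Rightarrow> 'b::metric_space"
  assumes "\<And>n. \<exists>g. homeomorphism UNIV UNIV (h n) g" "uniform_limit UNIV h f sequentially"
  shows "continuous_on UNIV f"
proof (rule uniform_limit_theorem[OF always_eventually assms(2)])
  show "\<forall>n. continuous_on UNIV (h n)" using assms(1) unfolding homeomorphism_def by blast
qed simp

lemma frontier_image_homeomorphism: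
  assumes "homeomorphism UNIV UNIV h g"
  shows "frontier (h ` V) \<subseteq> h ` frontier V"
proof -
  have img: "closure (h ` V) \<subseteq> h ` closure V"
  proof (rule closure_minimal)
    show "closed (h ` closure V)"
      using homeomorphism_imp_closed_map[OF assms, of "closure V"] by simp
  qed (use closure_subset in auto)
  have "open (h ` interior V)"
    using homeomorphism_imp_open_map[OF assms, of "interior V"] by simp
  then have int: "h ` interior V \<subseteq> interior (h ` V)"
    by (intro interior_maximal) (use interior_subset in auto)
  show ?thesis using img int unfolding frontier_def by blast
qed

text \<open>
  A point of a small connected neighbourhood of \<open>f x\<close> lies in \<open>h n ` V\<close> for all large \<open>n\<close>, because
  the neighbourhood avoids \<open>h n ` frontier V\<close>; a limit of its preimages is then mapped to it by \<open>f\<close>.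
\<close>

lemma open_image_minus_frontier:
  fixes f :: "'a::metric_space \<Rightarrow> 'b::metric_space"
  assumes surf: "metric_surface TYPE('b)"
    and h: "\<And>n. \<exists>g. homeomorphism UNIV UNIV (h n) g" and lim: "uniform_limit UNIV h f sequentially"
    and V: "open V" "compact (closure V)"
  shows "open (f ` V - f ` frontier V)"
proof (subst open_subopen, intro ballI)
  fix y assume "y \<in> f ` V - f ` frontier V"
  then obtain x where x: "x \<in> V" "y = f x" "f x \<notin> f ` frontier V" by auto
  have contf: "continuous_on UNIV f"
    by (rule uniform_limit_homeomorphisms_continuous) fact+
  have cfr: "compact (frontier V)"
    using compact_Int_closed[OF V(2) frontier_closed[of V]] by (simp add: frontier_def Int_absorb1 Diff_subset)
  then have "closed (f ` frontier V)"
    by (intro compact_imp_closed compact_continuous_image continuous_on_subset[OF contf]) auto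
  then obtain d where d0: "d > 0" "ball y d \<subseteq> - f ` frontier V"
    using openE[OF open_Compl] x by (metis ComplI)
  have d: "d \<le> dist y (f z)" if "z \<in> frontier V" for z
    using subsetD[OF d0(2), of "f z"] that by (metis ComplD imageI mem_ball not_le)
  \<comment> \<open>Half of the distance \<open>d\<close> is spent on the size of \<open>N\<close>
    and the other half on the uniform distance between \<open>h n\<close> and
    \<open>f\<close>.\<close>
  obtain N where N: "open N" "connected N" "y \<in> N" "N \<subseteq> ball y (d / 2)"
    using metric_surface_connected_neighbourhood[OF surf open_ball, of y y "d / 2"] d0(1) by auto
  have ev: "\<forall>\<^sub>F n in sequentially. N \<subseteq> h n ` V"
  proof -
    have "\<forall>\<^sub>F n in sequentially. \<forall>z\<in>UNIV. dist (h n z) (f z) < d / 2"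
      using uniform_limitD[OF lim, of "d / 2"] d0(1) by simp
    moreover have "\<forall>\<^sub>F n in sequentially. h n x \<in> N"
      using tendsto_uniform_limitI[OF lim, of x] N(1,3) x(2) by (auto simp: tendsto_def)
    ultimately show ?thesis
    proof eventually_elim
      case (elim n)
      obtain g where g: "homeomorphism UNIV UNIV (h n) g" using h by blast
      have "N \<inter> frontier (h n ` V) = {}"
      proof -
        have "h n z \<notin> N" if z: "z \<in> frontier V" for z
        proof
          assume "h n z \<in> N"
          then have "dist y (h n z) < d / 2" using N(4) by auto
          moreover have "dist (h n z) (f z) < d / 2" using elim(1) by simp
          ultimately show False using d[OF z] dist_triangle[of y "f z" "h n z"] by linarith
        qed
        then show ?thesis using frontier_image_homeomorphism[OF g, of V] by auto
      qed
      then show "N \<subseteq> h n ` V"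
        using connected_Int_frontier[OF N(2), of "h n ` V"] elim(2) x(1) by auto
    qed
  qed
  have "N \<subseteq> f ` V"
  proof
    fix z assume z: "z \<in> N"
    obtain n0 where "\<And>n. n \<ge> n0 \<Longrightarrow> N \<subseteq> h n ` V" using ev by (auto simp: eventually_sequentially)
    then have "\<forall>n. \<exists>w. w \<in> V \<and> h (n + n0) w = z" using z by (metis imageE le_add2 subsetD)
    then obtain w where w: "\<And>n. w n \<in> V" "\<And>n. h (n + n0) (w n) = z" by metis
    then have "\<forall>n. w n \<in> closure V" using closure_subset by blast
    then obtain w' r where r: "w' \<in> closure V" "strict_mono r" "(w \<circ> r) \<longlonglongrightarrow> w'"
      using V(2) unfolding compact_def by metis
    have "(\<lambda>n. f (w (r n))) \<longlonglongrightarrow> f w'"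
      using r(3) contf by (auto simp: o_def continuous_on_eq_continuous_at intro: isCont_tendsto_compose)
    \<comment> \<open>Here \<open>z = h (r n + n0) (w (r n))\<close>, so the distance to
      \<open>z\<close> is controlled by the uniform convergence alone, although the points
      \<open>w (r n)\<close> vary.\<close>
    moreover have "(\<lambda>n. f (w (r n))) \<longlonglongrightarrow> z"
    proof (rule metric_LIMSEQ_I)
      fix e :: real assume "e > 0"
      then obtain n1 where n1: "\<And>n u. n \<ge> n1 \<Longrightarrow> dist (h n u) (f u) < e"
        using uniform_limitD[OF lim \<open>e > 0\<close>] by (auto simp: eventually_sequentially)
      have "dist (f (w (r n))) z < e" if "n \<ge> n1" for n
        using n1[of "r n + n0" "w (r n)"] that w(2)[of "r n"] seq_suble[OF r(2), of n]
        by (simp add: dist_commute)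
      then show "\<exists>no. \<forall>n\<ge>no. dist (f (w (r n))) z < e" by blast
    qed
    ultimately have "f w' = z" by (rule LIMSEQ_unique)
    moreover have "z \<notin> f ` frontier V"
    proof
      assume "z \<in> f ` frontier V"
      then have "d \<le> dist y z" using d by auto
      then show False using z N(4) d0(1) by auto
    qed
    ultimately show "z \<in> f ` V"
      using r(1) V(1) by (auto simp: frontier_def interior_open)
  qed
  moreover have "N \<inter> f ` frontier V = {}"
  proof -
    have "dist y z < d" if "z \<in> N" for z using subsetD[OF N(4) that] d0(1) by simp
    then show ?thesis using d by fastforce
  qed
  ultimately show "\<exists>T. open T \<and> y \<in> T \<and> T \<subseteq> f ` V - f ` frontier V" using N by blast
qed

lemma weakly_monotone_bounded_on_compact:
  fixes u :: "'a::metric_space \<Rightarrow> real"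
  assumes "\<And>x::'a. \<exists>e>0. compact (cball x e)" "weakly_monotone u" "compact C"
  shows "(SUP x\<in>C. ereal (u x)) < \<infinity>" "(INF x\<in>C. ereal (u x)) > -\<infinity>"
proof -
  obtain W where W: "open W" "C \<subseteq> W" "compact (closure W)"
    using compact_contained_in_relatively_compact_open[OF assms(1,3)] by blast
  have w: "(SUP x\<in>W. ereal (u x)) \<le> (SUP x\<in>frontier W. ereal (u x))"
    "(SUP x\<in>frontier W. ereal (u x)) < \<infinity>"
    "(INF x\<in>W. ereal (u x)) \<ge> (INF x\<in>frontier W. ereal (u x))"
    "(INF x\<in>frontier W. ereal (u x)) > -\<infinity>"
    using assms(2) W unfolding weakly_monotone_def by blast+
  have "(SUP x\<in>C. ereal (u x)) \<le> (SUP x\<in>W. ereal (u x))"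
    using W(2) by (intro SUP_subset_mono) auto
  then show "(SUP x\<in>C. ereal (u x)) < \<infinity>" using w by (meson le_less_trans)
  have "(INF x\<in>W. ereal (u x)) \<le> (INF x\<in>C. ereal (u x))"
    using W(2) by (intro INF_superset_mono) auto
  then show "(INF x\<in>C. ereal (u x)) > -\<infinity>" using w by (meson less_le_trans)
qed

lemma weakly_monotone_comp:
  fixes f :: "'a::metric_space \<Rightarrow> 'b::metric_space" and u :: "'b \<Rightarrow> real"
  assumes surf: "metric_surface TYPE('b)"
    and h: "\<And>n. \<exists>g. homeomorphism UNIV UNIV (h n) g" and lim: "uniform_limit UNIV h f sequentially"
    and u: "weakly_monotone u"
  shows "weakly_monotone (u \<circ> f)"
  unfolding weakly_monotone_def
proof (intro allI impI, elim conjE)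
  fix V :: "'a set" assume V: "open V" "compact (closure V)"
  define W where "W = f ` V - f ` frontier V"
  have contf: "continuous_on A f" for A
    using uniform_limit_homeomorphisms_continuous[OF h lim] continuous_on_subset by blast
  have W: "open W" unfolding W_def by (rule open_image_minus_frontier) fact+
  have ccl: "compact (f ` closure V)" by (intro compact_continuous_image contf V)
  have clV: "closure V = V \<union> frontier V"
    using V(1) closure_subset[of V] by (auto simp: frontier_def interior_open)
  have cfr: "compact (f ` frontier V)"
    using compact_Int_closed[OF V(2) frontier_closed[of V]]
    by (intro compact_continuous_image contf) (simp add: frontier_def Int_absorb1 Diff_subset)
  have clW: "closure W \<subseteq> f ` closure V"
    using ccl unfolding W_def clV by (intro closure_minimal compact_imp_closed) auto
  have "compact (closure W)"
    using compact_Int_closed[OF ccl closed_closure[of W]] clW by (metis inf.absorb2)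
  then have w: "(SUP x\<in>W. ereal (u x)) \<le> (SUP x\<in>frontier W. ereal (u x))"
    "(INF x\<in>W. ereal (u x)) \<ge> (INF x\<in>frontier W. ereal (u x))"
    using u W unfolding weakly_monotone_def by blast+
  have frW: "frontier W \<subseteq> f ` frontier V"
  proof -
    have "frontier W \<subseteq> f ` closure V - W"
      using clW unfolding frontier_def interior_open[OF W] by (rule Diff_mono) simp
    also have "\<dots> \<subseteq> f ` frontier V" unfolding clV W_def by blast
    finally show ?thesis .
  qed
  \<comment> \<open>Points of \<open>V\<close> whose image falls outside \<open>W\<close> share
    their value under \<open>f\<close> with a frontier point, so the required bounds are immediate
    for them.\<close>
  have VW: "f ` V \<subseteq> W \<union> f ` frontier V" unfolding W_def by auto
  let ?S = "SUP x\<in>f ` frontier V. ereal (u x)" and ?I = "INF x\<in>f ` frontier V. ereal (u x)"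
  have "(SUP x\<in>frontier W. ereal (u x)) \<le> ?S" using frW by (intro SUP_subset_mono) auto
  then have "(SUP x\<in>W. ereal (u x)) \<le> ?S" using w(1) by (rule order_trans[rotated])
  then have "ereal (u x) \<le> ?S" if "x \<in> f ` V" for x
    using that VW by (metis (no_types, lifting) SUP_upper UnE order_trans subsetD)
  then have S: "(SUP x\<in>f ` V. ereal (u x)) \<le> ?S" by (rule SUP_least)
  have "?I \<le> (INF x\<in>frontier W. ereal (u x))" using frW by (intro INF_superset_mono) auto
  then have "?I \<le> (INF x\<in>W. ereal (u x))" using w(2) by (rule order_trans)
  then have "?I \<le> ereal (u x)" if "x \<in> f ` V" for x
    using that VW by (metis (no_types, lifting) INF_lower UnE order_trans subsetD)
  then have I: "?I \<le> (INF x\<in>f ` V. ereal (u x))" by (rule INF_greatest)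
  show "(SUP x\<in>V. ereal ((u \<circ> f) x)) \<le> (SUP x\<in>frontier V. ereal ((u \<circ> f) x)) \<and>
      (SUP x\<in>frontier V. ereal ((u \<circ> f) x)) < \<infinity> \<and>
      (INF x\<in>frontier V. ereal ((u \<circ> f) x)) \<le> (INF x\<in>V. ereal ((u \<circ> f) x)) \<and>
      - \<infinity> < (INF x\<in>frontier V. ereal ((u \<circ> f) x))"
    using S I weakly_monotone_bounded_on_compact[OF metric_surface_locally_compact[OF surf] u cfr]
    by (simp add: image_comp o_def)
qed

section \<open>Pulling back square-integrable functions\<close>

lemma admissible_function_pullback:
  fixes f :: "'a::metric_space \<Rightarrow> 'b::metric_space"
  assumes K: "K \<ge> 0"
    and qc: "\<forall>\<Gamma>. (\<forall>\<gamma>\<in>\<Gamma>. path \<gamma>) \<longrightarrow> modulus2 \<Gamma> \<le> ennreal K * modulus2 ((\<lambda>\<gamma>. f \<circ> \<gamma>) ` \<Gamma>)"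
    and contf: "continuous_on UNIV f"
    and [measurable]: "\<sigma> \<in> borel_measurable borel"
    and b: "(\<integral>\<^sup>+x. (\<sigma> x)\<^sup>2 \<partial>hausdorff_measure 2) = ennreal b" "b \<ge> 0" and \<epsilon>: "\<epsilon> > 0"
  shows "\<exists>r\<in>borel_measurable borel. (\<integral>\<^sup>+x. (r x)\<^sup>2 \<partial>hausdorff_measure 2) \<le> ennreal ((K * b + 1) / \<epsilon>\<^sup>2) \<and>
    (\<forall>\<gamma>. path \<gamma> \<longrightarrow> ennreal \<epsilon> \<le> path_nn_integral (f \<circ> \<gamma>) \<sigma> \<longrightarrow> 1 \<le> path_nn_integral \<gamma> r)"
proof -
  define \<Gamma> where "\<Gamma> = {\<gamma>. path \<gamma> \<and> ennreal \<epsilon> \<le> path_nn_integral (f \<circ> \<gamma>) \<sigma>}"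
  define \<tau> where "\<tau> x = ennreal (1 / \<epsilon>) * \<sigma> x" for x
  have [measurable]: "\<tau> \<in> borel_measurable borel" unfolding \<tau>_def by measurable
  have "1 \<le> path_nn_integral (f \<circ> \<gamma>) \<tau>" if "\<gamma> \<in> \<Gamma>" for \<gamma>
  proof -
    have "path (f \<circ> \<gamma>)"
      using that by (auto simp: \<Gamma>_def intro!: path_continuous_image continuous_on_subset[OF contf])
    then have "path_nn_integral (f \<circ> \<gamma>) \<tau> = ennreal (1 / \<epsilon>) * path_nn_integral (f \<circ> \<gamma>) \<sigma>"
      unfolding path_nn_integral_eq \<tau>_def by (intro curve_integral_cmult) auto
    also have "\<dots> \<ge> ennreal (1 / \<epsilon>) * ennreal \<epsilon>"
      using that by (intro mult_left_mono) (auto simp: \<Gamma>_def)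
    also have "ennreal (1 / \<epsilon>) * ennreal \<epsilon> = 1" using \<epsilon> by (simp flip: ennreal_mult)
    finally show ?thesis .
  qed
  then have "modulus2 ((\<lambda>\<gamma>. f \<circ> \<gamma>) ` \<Gamma>) \<le> (\<integral>\<^sup>+x. (\<tau> x)\<^sup>2 \<partial>hausdorff_measure 2)"
    unfolding modulus2_def by (intro INF_lower) auto
  also have "\<dots> = ennreal ((1 / \<epsilon>)\<^sup>2) * ennreal b"
    using \<epsilon> by (simp add: \<tau>_def power_mult_distrib nn_integral_cmult b(1) ennreal_power)
  also have "\<dots> = ennreal (b / \<epsilon>\<^sup>2)" using b(2) by (simp add: power_one_over flip: ennreal_mult)
  finally have "ennreal K * modulus2 ((\<lambda>\<gamma>. f \<circ> \<gamma>) ` \<Gamma>) \<le> ennreal K * ennreal (b / \<epsilon>\<^sup>2)"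
    by (rule mult_left_mono) simp
  then have "modulus2 \<Gamma> \<le> ennreal K * ennreal (b / \<epsilon>\<^sup>2)"
    by (intro order_trans[OF qc[rule_format]]) (auto simp: \<Gamma>_def)
  also have "\<dots> = ennreal (K * b / \<epsilon>\<^sup>2)" using K b(2) by (simp flip: ennreal_mult)
  \<comment> \<open>The infimum in the modulus need not be attained. The added 1 makes the bound
    strict, even for \<open>K * b = 0\<close>, and it is divided by the same
    \<open>\<epsilon>\<^sup>2\<close>, so that rescaling \<open>r\<close> by \<epsilon> leaves a
    constant.\<close>
  also have "\<dots> < ennreal ((K * b + 1) / \<epsilon>\<^sup>2)"
    using K b(2) \<epsilon> by (intro ennreal_lessI) (auto simp: divide_strict_right_mono intro!: divide_pos_pos add_nonneg_pos)
  finally obtain r where "r \<in> borel_measurable borel" "\<forall>\<gamma>\<in>\<Gamma>. 1 \<le> path_nn_integral \<gamma> r"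
    "(\<integral>\<^sup>+x. (r x)\<^sup>2 \<partial>hausdorff_measure 2) < ennreal ((K * b + 1) / \<epsilon>\<^sup>2)"
    unfolding modulus2_def INF_less_iff by blast
  then show ?thesis unfolding \<Gamma>_def by (intro bexI[of _ r]) auto
qed

text \<open>The two kinds of paths get separate summands. For a finite integral of \<sigma>, the
  functions satisfying the inequality up to an error form decreasing classes that are closed under
  midpoints and contain members of bounded energy, so they have a common majorant \<open>G\<close>.
  A path with infinite integral of \<sigma> belongs to the family at every scale \<epsilon>; large
  scales make the admissible functions small in energy, and their sum \<open>H\<close> has infinite
  integral along the path.\<close>

lemma square_integrable_pullback:
  fixes f :: "'a::metric_space \<Rightarrow> 'b::metric_space"
  assumes K: "K \<ge> 0"
    and qc: "\<forall>\<Gamma>. (\<forall>\<gamma>\<in>\<Gamma>. path \<gamma>) \<longrightarrow> modulus2 \<Gamma> \<le> ennreal K * modulus2 ((\<lambda>\<gamma>. f \<circ> \<gamma>) ` \<Gamma>)"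
    and contf: "continuous_on UNIV f"
    and \<sigma>: "\<sigma> \<in> borel_measurable borel" and fin: "(\<integral>\<^sup>+x. (\<sigma> x)\<^sup>2 \<partial>hausdorff_measure 2) < \<infinity>"
  shows "\<exists>G\<in>borel_measurable borel. (\<integral>\<^sup>+x. (G x)\<^sup>2 \<partial>hausdorff_measure 2) < \<infinity> \<and>
    (\<forall>\<gamma>. path \<gamma> \<longrightarrow> path_nn_integral (f \<circ> \<gamma>) \<sigma> \<le> path_nn_integral \<gamma> G)"
proof -
  obtain b where b: "(\<integral>\<^sup>+x. (\<sigma> x)\<^sup>2 \<partial>hausdorff_measure 2) = ennreal b" "b \<ge> 0"
    using fin by (cases "\<integral>\<^sup>+x. (\<sigma> x)\<^sup>2 \<partial>hausdorff_measure 2") auto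
  define C where "C = K * b + 1"
  have C: "C > 0" using K b by (auto simp: C_def intro: add_nonneg_pos)
  note adm = admissible_function_pullback[OF K qc contf \<sigma> b, folded C_def]
  define S where "S n = {g \<in> borel_measurable borel. \<forall>\<gamma>. path \<gamma> \<longrightarrow> path_nn_integral (f \<circ> \<gamma>) \<sigma> < \<infinity> \<longrightarrow>
      path_nn_integral (f \<circ> \<gamma>) \<sigma> \<le> path_nn_integral \<gamma> g + ennreal (inverse (real (Suc n)))}" for n
  have pf: "path (f \<circ> \<gamma>)" if "path \<gamma>" for \<gamma>
    using that by (intro path_continuous_image continuous_on_subset[OF contf]) auto
  have "\<exists>G\<in>borel_measurable (hausdorff_measure 2). (\<integral>\<^sup>+x. (G x)\<^sup>2 \<partial>hausdorff_measure 2) < \<infinity> \<and>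
      (\<forall>n. \<exists>g\<in>S n. \<forall>x. g x \<le> G x)"
  proof (rule square_integrable_majorant)
    show "g \<in> S n \<Longrightarrow> g \<in> borel_measurable (hausdorff_measure 2)" for g n
      by (simp add: S_def measurable_cong_sets[OF sets_hausdorff_measure refl])
    show "decseq S"
    proof (intro decseq_SucI subsetI)
      fix n g assume g: "g \<in> S (Suc n)"
      have le: "ennreal (inverse (real (Suc (Suc n)))) \<le> ennreal (inverse (real (Suc n)))"
        by (intro ennreal_leI le_imp_inverse_le) auto
      have "path_nn_integral (f \<circ> \<gamma>) \<sigma> \<le> path_nn_integral \<gamma> g + ennreal (inverse (real (Suc n)))"
        if "path \<gamma>" "path_nn_integral (f \<circ> \<gamma>) \<sigma> < \<infinity>" for \<gamma>
      proof -
        have "path_nn_integral (f \<circ> \<gamma>) \<sigma>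
            \<le> path_nn_integral \<gamma> g + ennreal (inverse (real (Suc (Suc n))))"
          using g that unfolding S_def by blast
        also have "\<dots> \<le> path_nn_integral \<gamma> g + ennreal (inverse (real (Suc n)))"
          by (rule add_left_mono[OF le])
        finally show ?thesis .
      qed
      then show "g \<in> S n" using g unfolding S_def by blast
    qed
    show "(\<lambda>x. (g x + h x) / 2) \<in> S n" if "g \<in> S n" "h \<in> S n" for g h n
    proof -
      have [measurable]: "g \<in> borel_measurable borel" "h \<in> borel_measurable borel"
        using that by (auto simp: S_def)
      have "path_nn_integral (f \<circ> \<gamma>) \<sigma> \<le>
          path_nn_integral \<gamma> (\<lambda>x. (g x + h x) / 2) + ennreal (inverse (real (Suc n)))"
        if \<gamma>: "path \<gamma>" "path_nn_integral (f \<circ> \<gamma>) \<sigma> < \<infinity>" for \<gamma>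
      proof -
        have eq: "path_nn_integral \<gamma> (\<lambda>x. (g x + h x) / 2)
            = inverse 2 * (path_nn_integral \<gamma> g + path_nn_integral \<gamma> h)"
          using curve_integral_cmult[OF \<gamma>(1), of 0 1 "\<lambda>x. g x + h x" "inverse 2"]
            curve_integral_add[OF \<gamma>(1), of 0 1 g h]
          by (simp add: path_nn_integral_eq divide_ennreal_def mult.commute)
        let ?a = "path_nn_integral (f \<circ> \<gamma>) \<sigma>" and ?e = "ennreal (inverse (real (Suc n)))"
        have half: "inverse 2 * (z + z) = z" for z :: ennreal
        proof -
          have "inverse 2 * 2 = (1::ennreal)"
            using ennreal_divide_self[of 2] by (simp add: divide_ennreal_def mult.commute)
          then show ?thesis by (simp add: mult_2[symmetric] mult.assoc[symmetric])
        qed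
        have "?a + ?a \<le> (path_nn_integral \<gamma> g + ?e) + (path_nn_integral \<gamma> h + ?e)"
          using \<open>g \<in> S n\<close> \<open>h \<in> S n\<close> \<gamma> unfolding S_def by (intro add_mono) auto
        then have "inverse 2 * (?a + ?a) \<le>
            inverse 2 * ((path_nn_integral \<gamma> g + path_nn_integral \<gamma> h) + (?e + ?e))"
          by (intro mult_left_mono) (auto simp: ac_simps)
        then show ?thesis unfolding half eq distrib_left[of _ _ "?e + ?e"] .
      qed
      then show ?thesis by (simp add: S_def)
    qed
    show "\<exists>g\<in>S n. (\<integral>\<^sup>+x. (g x)\<^sup>2 \<partial>hausdorff_measure 2) \<le> ennreal C" for n
    proof -
      \<comment> \<open>The remainder of length less than \<epsilon> left by the cutting is exactly
        the error that \<open>S n\<close> tolerates.\<close>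
      define \<epsilon> where "\<epsilon> = inverse (real (Suc n))"
      have \<epsilon>: "\<epsilon> > 0" by (simp add: \<epsilon>_def)
      obtain r where [measurable]: "r \<in> borel_measurable borel"
        and r: "(\<integral>\<^sup>+x. (r x)\<^sup>2 \<partial>hausdorff_measure 2) \<le> ennreal (C / \<epsilon>\<^sup>2)"
          "\<And>\<gamma>. path \<gamma> \<Longrightarrow> ennreal \<epsilon> \<le> path_nn_integral (f \<circ> \<gamma>) \<sigma> \<Longrightarrow> 1 \<le> path_nn_integral \<gamma> r"
        using adm[OF \<epsilon>] by blast
      have "path_nn_integral (f \<circ> \<gamma>) \<sigma> \<le> path_nn_integral \<gamma> (\<lambda>x. ennreal \<epsilon> * r x) + ennreal \<epsilon>"
        if \<gamma>: "path \<gamma>" "path_nn_integral (f \<circ> \<gamma>) \<sigma> < \<infinity>" for \<gamma>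
      proof -
        have unit: "1 \<le> curve_integral \<gamma> {s..t} r"
          if st: "0 \<le> s" "s < t" "t \<le> 1" "ennreal \<epsilon> \<le> curve_integral (f \<circ> \<gamma>) {s..t} \<sigma>" for s t
        proof -
          have "f \<circ> path_piece s t \<gamma> = path_piece s t (f \<circ> \<gamma>)" by (auto simp: path_piece_def)
          then have "ennreal \<epsilon> \<le> path_nn_integral (f \<circ> path_piece s t \<gamma>) \<sigma>"
            using st by (simp add: path_nn_integral_path_piece)
          then have "1 \<le> path_nn_integral (path_piece s t \<gamma>) r"
            using st \<gamma>(1) by (intro r path_path_piece) auto
          then show ?thesis using st by (simp add: path_nn_integral_path_piece)
        qed
        have "curve_integral (f \<circ> \<gamma>) {0..1} \<sigma> \<le> ennreal \<epsilon> * curve_integral \<gamma> {0..1} r + ennreal \<epsilon>"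
          by (rule curve_integral_le_chop[OF pf[OF \<gamma>(1)] \<sigma> \<gamma>(1) _ _ \<epsilon> unit])
            (use \<gamma>(2) in \<open>auto simp: path_nn_integral_eq\<close>)
        then show ?thesis by (simp add: path_nn_integral_eq curve_integral_cmult[OF \<gamma>(1)])
      qed
      then have "(\<lambda>x. ennreal \<epsilon> * r x) \<in> S n" by (simp add: S_def \<epsilon>_def)
      moreover have "(\<integral>\<^sup>+x. (ennreal \<epsilon> * r x)\<^sup>2 \<partial>hausdorff_measure 2) \<le> ennreal C"
      proof -
        have "(\<integral>\<^sup>+x. (ennreal \<epsilon> * r x)\<^sup>2 \<partial>hausdorff_measure 2)
            = ennreal (\<epsilon>\<^sup>2) * (\<integral>\<^sup>+x. (r x)\<^sup>2 \<partial>hausdorff_measure 2)"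
          using \<epsilon> by (simp add: power_mult_distrib nn_integral_cmult ennreal_power)
        also have "\<dots> \<le> ennreal (\<epsilon>\<^sup>2) * ennreal (C / \<epsilon>\<^sup>2)" by (intro mult_left_mono r) simp
        also have "\<dots> = ennreal C" using \<epsilon> C by (simp flip: ennreal_mult)
        finally show ?thesis .
      qed
      ultimately show ?thesis by (intro bexI[of _ "\<lambda>x. ennreal \<epsilon> * r x"])
    qed
  qed simp
  then obtain G where [measurable]: "G \<in> borel_measurable borel"
    and G: "(\<integral>\<^sup>+x. (G x)\<^sup>2 \<partial>hausdorff_measure 2) < \<infinity>" "\<And>n. \<exists>g\<in>S n. \<forall>x. g x \<le> G x"
    by (auto simp: measurable_cong_sets[OF sets_hausdorff_measure refl])
  have finite_case: "path_nn_integral (f \<circ> \<gamma>) \<sigma> \<le> path_nn_integral \<gamma> G"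
    if \<gamma>: "path \<gamma>" "path_nn_integral (f \<circ> \<gamma>) \<sigma> < \<infinity>" for \<gamma>
  proof (rule ennreal_le_epsilon)
    fix e :: real assume "e > 0"
    then obtain n where n: "inverse (real (Suc n)) < e" using reals_Archimedean by blast
    obtain g where g: "g \<in> S n" "\<And>x. g x \<le> G x" using G(2) by blast
    have "path_nn_integral (f \<circ> \<gamma>) \<sigma> \<le> path_nn_integral \<gamma> g + ennreal (inverse (real (Suc n)))"
      using g(1) \<gamma> unfolding S_def by blast
    also have "\<dots> \<le> path_nn_integral \<gamma> G + ennreal e"
      unfolding path_nn_integral_eq using n g(2)
      by (intro add_mono curve_integral_mono ennreal_leI) auto
    finally show "path_nn_integral (f \<circ> \<gamma>) \<sigma> \<le> path_nn_integral \<gamma> G + ennreal e" .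
  qed
  \<comment> \<open>The scale is now \<open>\<epsilon> = 2 ^ k\<close>: the energy bound
    \<open>C / \<epsilon>\<^sup>2\<close> decays like \<open>(1/4) ^ k\<close>, while paths with
    infinite integral still meet the threshold.\<close>
  have "\<exists>r\<in>borel_measurable borel. (\<integral>\<^sup>+x. (r x)\<^sup>2 \<partial>hausdorff_measure 2) \<le> ennreal (C * (1/4) ^ k) \<and>
      (\<forall>\<gamma>. path \<gamma> \<longrightarrow> path_nn_integral (f \<circ> \<gamma>) \<sigma> = \<infinity> \<longrightarrow> 1 \<le> path_nn_integral \<gamma> r)" for k :: nat
  proof -
    have eq: "C / (2 ^ k)\<^sup>2 = C * (1/4) ^ k"
      by (simp add: power_one_over power2_eq_square flip: power_mult_distrib)
    have "(0::real) < 2 ^ k" by simp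
    from adm[OF this] obtain r where "r \<in> borel_measurable borel"
      "(\<integral>\<^sup>+x. (r x)\<^sup>2 \<partial>hausdorff_measure 2) \<le> ennreal (C * (1/4) ^ k)"
      "\<And>\<gamma>. path \<gamma> \<Longrightarrow> ennreal (2 ^ k) \<le> path_nn_integral (f \<circ> \<gamma>) \<sigma> \<Longrightarrow> 1 \<le> path_nn_integral \<gamma> r"
      unfolding eq by blast
    then show ?thesis by (intro bexI[of _ r] conjI allI impI) (simp_all only: infinity_ennreal_def top_greatest)
  qed
  then obtain r where [measurable]: "\<And>k. r k \<in> borel_measurable borel"
    and r: "\<And>k::nat. (\<integral>\<^sup>+x. (r k x)\<^sup>2 \<partial>hausdorff_measure 2) \<le> ennreal (C * (1/4) ^ k)"
      "\<And>k \<gamma>. path \<gamma> \<Longrightarrow> path_nn_integral (f \<circ> \<gamma>) \<sigma> = \<infinity> \<Longrightarrow> 1 \<le> path_nn_integral \<gamma> (r k)"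
    by metis
  define H where "H x = (\<Sum>k. r k x)" for x
  have [measurable]: "H \<in> borel_measurable borel" unfolding H_def by measurable
  have H: "(\<integral>\<^sup>+x. (H x)\<^sup>2 \<partial>hausdorff_measure 2) < \<infinity>"
    unfolding H_def using r(1) C
    by (intro nn_integral_suminf_power2_finite[where c=C]) auto
  have infinite_case: "path_nn_integral \<gamma> H = \<infinity>"
    if \<gamma>: "path \<gamma>" "path_nn_integral (f \<circ> \<gamma>) \<sigma> = \<infinity>" for \<gamma>
  proof -
    have "(\<Sum>k. 1) \<le> (\<Sum>k. path_nn_integral \<gamma> (r k))"
      by (intro suminf_le r(2)[OF \<gamma>]) auto
    also have "\<dots> = path_nn_integral \<gamma> H"
      unfolding path_nn_integral_eq H_def using curve_integral_suminf[OF \<gamma>(1), of 0 1 r] by simp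
    also have "(\<Sum>k::nat. 1::ennreal) = top"
      by (subst suminf_eq_SUP) (simp add: ennreal_SUP_of_nat_eq_top)
    finally show ?thesis by (simp add: top_unique)
  qed
  let ?G = "\<lambda>x. G x + H x"
  have "(\<integral>\<^sup>+x. (?G x)\<^sup>2 \<partial>hausdorff_measure 2)
      \<le> (\<integral>\<^sup>+x. 2 * (G x)\<^sup>2 + 2 * (H x)\<^sup>2 \<partial>hausdorff_measure 2)"
    by (intro nn_integral_mono ennreal_power2_add_le)
  also have "\<dots> < \<infinity>"
    using G(1) H by (subst nn_integral_add) (auto simp: nn_integral_cmult ennreal_mult_less_top)
  finally have fin': "(\<integral>\<^sup>+x. (?G x)\<^sup>2 \<partial>hausdorff_measure 2) < \<infinity>" .
  have "path_nn_integral (f \<circ> \<gamma>) \<sigma> \<le> path_nn_integral \<gamma> ?G" if "path \<gamma>" for \<gamma>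
  proof -
    have "path_nn_integral \<gamma> ?G = path_nn_integral \<gamma> G + path_nn_integral \<gamma> H"
      unfolding path_nn_integral_eq using that by (intro curve_integral_add) auto
    then show ?thesis
      using finite_case[OF that] infinite_case[OF that]
      by (cases "path_nn_integral (f \<circ> \<gamma>) \<sigma> = \<infinity>") (auto simp: less_top add_increasing2)
  qed
  with fin' show ?thesis by (intro bexI[of _ ?G]) auto
qed

lemma upper_gradient_comp_on_compact:
  fixes f :: "'a::metric_space \<Rightarrow> 'b::metric_space"
  assumes K: "K \<ge> 0"
    and qc: "\<forall>\<Gamma>. (\<forall>\<gamma>\<in>\<Gamma>. path \<gamma>) \<longrightarrow> modulus2 \<Gamma> \<le> ennreal K * modulus2 ((\<lambda>\<gamma>. f \<circ> \<gamma>) ` \<Gamma>)"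
    and contf: "continuous_on UNIV f"
    and fin: "\<And>C::'b set. compact C \<Longrightarrow> emeasure (hausdorff_measure 2) C < \<infinity>"
    and ug: "upper_gradient u \<rho>" and li: "locally_2_integrable \<rho>" and A: "compact A"
  shows "\<exists>G\<in>borel_measurable borel. (\<integral>\<^sup>+x. (G x)\<^sup>2 \<partial>hausdorff_measure 2) < \<infinity> \<and>
    (\<forall>\<gamma>. path \<gamma> \<longrightarrow> path_image \<gamma> \<subseteq> A \<longrightarrow>
      ennreal \<bar>u (f (pathstart \<gamma>)) - u (f (pathfinish \<gamma>))\<bar> \<le> path_nn_integral \<gamma> G)"
proof -
  have fA: "compact (f ` A)" by (intro compact_continuous_image continuous_on_subset[OF contf] A) auto
  then have [measurable]: "f ` A \<in> sets borel" by (rule borel_compact)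
  have [measurable]: "\<rho> \<in> borel_measurable borel" using ug by (simp add: upper_gradient_def)
  \<comment> \<open>Cutting off outside the compact image makes \<sigma> globally square-integrable:
    the constant 1 is paid for by the finite measure of compact sets, and \<rho> is locally
    square-integrable.\<close>
  define \<sigma> where "\<sigma> x = (1 + \<rho> x) * indicator (f ` A) x" for x
  have [measurable]: "\<sigma> \<in> borel_measurable borel" unfolding \<sigma>_def by measurable
  have "(\<integral>\<^sup>+x. (\<sigma> x)\<^sup>2 \<partial>hausdorff_measure 2)
      \<le> (\<integral>\<^sup>+x. 2 * indicator (f ` A) x + 2 * ((\<rho> x)\<^sup>2 * indicator (f ` A) x) \<partial>hausdorff_measure 2)"
    using ennreal_power2_add_le[of 1]
    by (intro nn_integral_mono) (auto simp: \<sigma>_def indicator_def)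
  also have "\<dots> = 2 * emeasure (hausdorff_measure 2) (f ` A) + 2 * (\<integral>\<^sup>+x\<in>f ` A. \<rho> x ^ 2 \<partial>hausdorff_measure 2)"
    by (subst nn_integral_add) (auto simp: nn_integral_cmult)
  also have "\<dots> < \<infinity>"
    using fin[OF fA] li fA by (auto simp: locally_2_integrable_def ennreal_mult_less_top)
  finally obtain G where G: "G \<in> borel_measurable borel" "(\<integral>\<^sup>+x. (G x)\<^sup>2 \<partial>hausdorff_measure 2) < \<infinity>"
    "\<And>\<gamma>. path \<gamma> \<Longrightarrow> path_nn_integral (f \<circ> \<gamma>) \<sigma> \<le> path_nn_integral \<gamma> G"
    using square_integrable_pullback[OF K qc contf, of \<sigma>] by auto
  have "ennreal \<bar>u (f (pathstart \<gamma>)) - u (f (pathfinish \<gamma>))\<bar> \<le> path_nn_integral \<gamma> G"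
    if \<gamma>: "path \<gamma>" "path_image \<gamma> \<subseteq> A" for \<gamma>
  proof (cases "path_nn_integral \<gamma> G = \<infinity>")
    \<comment> \<open>A finite integral of \<open>G\<close> forces a finite integral of \<sigma>
      along the image path, whose length is bounded by the contribution of the constant 1. The image
      path is therefore rectifiable and \<rho> may be applied to it.\<close>
    case False
    have im: "(f \<circ> \<gamma>) ` {0..1} \<subseteq> f ` A" using \<gamma>(2) by (auto simp: path_image_def)
    have pf: "path (f \<circ> \<gamma>)"
      using \<gamma>(1) by (intro path_continuous_image continuous_on_subset[OF contf]) auto
    have le: "g x \<le> \<sigma> x" if "x \<in> (f \<circ> \<gamma>) ` {0..1}" "g x \<le> 1 + \<rho> x" for g x
      using that im by (auto simp: \<sigma>_def indicator_def)
    have "path_length (f \<circ> \<gamma>) \<le> curve_integral (f \<circ> \<gamma>) {0..1} (\<lambda>_. 1)"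
      by (rule path_length_le_curve_integral[OF pf])
    also have "\<dots> \<le> path_nn_integral (f \<circ> \<gamma>) \<sigma>"
      unfolding path_nn_integral_eq by (intro curve_integral_mono le) auto
    also have "\<dots> < \<infinity>" using False G(3)[OF \<gamma>(1)] by (auto simp: less_top top_unique)
    finally have "rectifiable (f \<circ> \<gamma>)" using pf by (simp add: rectifiable_def)
    then have "ennreal \<bar>u (f (pathstart \<gamma>)) - u (f (pathfinish \<gamma>))\<bar> \<le> path_nn_integral (f \<circ> \<gamma>) \<rho>"
      using ug by (auto simp: upper_gradient_def pathstart_compose pathfinish_compose)
    also have "\<dots> \<le> path_nn_integral (f \<circ> \<gamma>) \<sigma>"
      unfolding path_nn_integral_eq by (intro curve_integral_mono le) auto
    also have "\<dots> \<le> path_nn_integral \<gamma> G" by (rule G(3)[OF \<gamma>(1)])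
    finally show ?thesis .
  qed simp
  then show ?thesis using G(1,2) by (intro bexI[of _ G]) auto
qed

section \<open>Gluing over a partition into open sets\<close>

text \<open>The \<eta>-neighbourhood of \<open>E\<close> has diameter at most
  \<open>diameter E + 2 * \<eta>\<close>, and the weight depends continuously on the
  diameter.\<close>

lemma open_superset_hausdorff_weight:
  fixes E :: "'a::metric_space set"
  assumes E: "bounded E" and e: "e > 0"
  shows "\<exists>V. open V \<and> E \<subseteq> V \<and> bounded V \<and> diameter V \<le> diameter E + e \<and>
    hausdorff_weight m V \<le> hausdorff_weight m E + ennreal e"
proof -
  define \<phi> where "\<phi> \<eta> = unit_ball_vol (real m) * ((diameter E + 2 * \<eta>) / 2) ^ m" for \<eta>
  have "isCont \<phi> 0" unfolding \<phi>_def by (intro continuous_intros) auto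
  then obtain d where d: "d > 0" "\<And>\<eta>. \<bar>\<eta>\<bar> < d \<Longrightarrow> \<bar>\<phi> \<eta> - \<phi> 0\<bar> < e"
    using e unfolding continuous_at_eps_delta by (auto simp: dist_real_def)
  define \<eta> where "\<eta> = min (d / 2) (e / 2)"
  have \<eta>: "\<eta> > 0" "\<eta> < d" "2 * \<eta> \<le> e" using d e by (auto simp: \<eta>_def)
  define V where "V = (\<Union>x\<in>E. ball x \<eta>)"
  have dist: "dist x y \<le> diameter E + 2 * \<eta>" if xy: "x \<in> V" "y \<in> V" for x y
  proof -
    obtain a b where ab: "a \<in> E" "dist a x < \<eta>" "b \<in> E" "dist b y < \<eta>"
      using xy unfolding V_def by auto
    have "dist x y \<le> dist a x + (dist a b + dist b y)"
      using dist_triangle[of x y a] dist_triangle[of a y b] by (simp add: dist_commute)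
    then show ?thesis using ab diameter_bounded_bound[OF E, of a b] by linarith
  qed
  have bV: "bounded V" using dist unfolding bounded_two_points by blast
  have dV: "diameter V \<le> diameter E + 2 * \<eta>"
  proof (cases "V = {}")
    case False
    then show ?thesis
      unfolding diameter_def[of V] using dist by (auto intro!: cSUP_least)
  qed (use \<eta> diameter_ge_0[OF E] in auto)
  have "hausdorff_weight m V \<le> ennreal (\<phi> \<eta>)"
    unfolding hausdorff_weight_def \<phi>_def
    by (intro ennreal_leI mult_left_mono power_mono divide_right_mono dV)
      (auto simp: diameter_ge_0[OF bV])
  also have "\<dots> \<le> ennreal (\<phi> 0 + e)" using d(2)[of \<eta>] \<eta> by (intro ennreal_leI) auto
  also have "\<dots> = hausdorff_weight m E + ennreal e"
    unfolding hausdorff_weight_def using e diameter_ge_0[OF E] by (subst ennreal_plus) (auto simp: \<phi>_def)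
  finally have "hausdorff_weight m V \<le> hausdorff_weight m E + ennreal e" .
  moreover have "open V" "E \<subseteq> V" using \<eta>(1) by (auto simp: V_def)
  ultimately show ?thesis using bV dV \<eta>(3) by (intro exI[of _ V]) auto
qed

text \<open>A single open superset of nearly the same measure need not exist: every open set around
  a segment in the plane has infinite 1-dimensional measure. At a fixed scale, however, a
  near-optimal cover can be thickened to an open one, which controls \<open>hausdorff_pre\<close>;
  intersecting over all scales then controls \<open>hausdorff_outer\<close>.\<close>

lemma hausdorff_outer_open_hull:
  fixes A :: "'a::metric_space set"
  assumes "hausdorff_outer m A < \<infinity>"
  shows "\<exists>U::nat \<Rightarrow> 'a set. (\<forall>n. open (U n) \<and> A \<subseteq> U n) \<and> hausdorff_outer m (\<Inter>n. U n) \<le> hausdorff_outer m A"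
proof -
  define d where "d n = inverse (real (Suc n))" for n
  have d: "d n > 0" for n by (simp add: d_def)
  have "\<exists>U. open U \<and> A \<subseteq> U \<and> hausdorff_pre m (2 * d n) U \<le> hausdorff_outer m A + ennreal (2 * d n)" for n
  proof -
    have "hausdorff_pre m (d n) A \<le> hausdorff_outer m A" by (rule hausdorff_pre_le_outer[OF d])
    also have "\<dots> < hausdorff_outer m A + ennreal (d n)" using assms d[of n] by auto
    finally obtain E where E: "A \<subseteq> (\<Union>i. E i)" "\<And>i. bounded (E i)" "\<And>i. diameter (E i) \<le> d n"
      "(\<Sum>i. hausdorff_weight m (E i)) < hausdorff_outer m A + ennreal (d n)"
      using hausdorff_pre_close by metis
    define e where "e i = d n * (1/2) ^ Suc i" for i :: nat
    have e: "e i > 0" "e i \<le> d n" for i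
      using d[of n] power_le_one[of "1/2::real" "Suc i"] by (auto simp: e_def intro!: mult_left_le)
    have "\<exists>V. open V \<and> E i \<subseteq> V \<and> bounded V \<and> diameter V \<le> diameter (E i) + e i \<and>
        hausdorff_weight m V \<le> hausdorff_weight m (E i) + ennreal (e i)" for i
      by (rule open_superset_hausdorff_weight[OF E(2) e(1)])
    then obtain V where V: "\<And>i. open (V i)" "\<And>i. E i \<subseteq> V i" "\<And>i. bounded (V i)"
      "\<And>i. diameter (V i) \<le> diameter (E i) + e i"
      "\<And>i. hausdorff_weight m (V i) \<le> hausdorff_weight m (E i) + ennreal (e i)" by metis
    have "diameter (V i) \<le> 2 * d n" for i using V(4)[of i] E(3)[of i] e(2)[of i] by linarith
    then have "hausdorff_pre m (2 * d n) (\<Union>i. V i) \<le> (\<Sum>i. hausdorff_weight m (V i))"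
      by (intro hausdorff_pre_le V) auto
    also have "\<dots> \<le> (\<Sum>i. hausdorff_weight m (E i) + ennreal (e i))"
      by (intro suminf_le V(5)) auto
    also have "\<dots> = (\<Sum>i. hausdorff_weight m (E i)) + (\<Sum>i. ennreal (e i))"
      by (rule suminf_add[symmetric]) auto
    also have "(\<Sum>i. ennreal (e i)) = ennreal (d n)"
    proof (rule suminf_ennreal_eq)
      show "e sums d n" unfolding e_def using sums_mult[OF power_half_series, of "d n"] by simp
    qed (use e less_imp_le in blast)
    also have "(\<Sum>i. hausdorff_weight m (E i)) + ennreal (d n) \<le>
        (hausdorff_outer m A + ennreal (d n)) + ennreal (d n)"
      using E(4) by (intro add_right_mono) simp
    also have "\<dots> = hausdorff_outer m A + ennreal (2 * d n)"
      using d[of n] by (simp add: add.assoc flip: ennreal_plus)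
    finally show ?thesis using E(1) V(1,2) by (intro exI[of _ "\<Union>i. V i"]) blast
  qed
  then obtain U where U: "\<And>n. open (U n)" "\<And>n. A \<subseteq> U n"
    "\<And>n. hausdorff_pre m (2 * d n) (U n) \<le> hausdorff_outer m A + ennreal (2 * d n)" by metis
  have "hausdorff_outer m (\<Inter>n. U n) \<le> hausdorff_outer m A"
    unfolding hausdorff_outer_def[of m "\<Inter>n. U n"]
  proof (rule SUP_least, rule ennreal_le_epsilon)
    fix \<delta> e :: real assume "\<delta> \<in> {0<..}" "0 < e"
    then obtain n where "d n < min (\<delta> / 2) (e / 2)"
      using reals_Archimedean[of "min (\<delta> / 2) (e / 2)"] unfolding d_def by auto
    then have n: "2 * d n \<le> \<delta>" "2 * d n \<le> e" by auto
    have "hausdorff_pre m \<delta> (\<Inter>n. U n) \<le> hausdorff_pre m (2 * d n) (\<Inter>n. U n)"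
      by (rule hausdorff_pre_antimono[OF n(1)])
    also have "\<dots> \<le> hausdorff_pre m (2 * d n) (U n)" by (intro hausdorff_pre_mono) auto
    also have "\<dots> \<le> hausdorff_outer m A + ennreal (2 * d n)" by (rule U(3))
    also have "\<dots> \<le> hausdorff_outer m A + ennreal e" using n(2) by (intro add_left_mono ennreal_leI)
    finally show "hausdorff_pre m \<delta> (\<Inter>n. U n) \<le> hausdorff_outer m A + ennreal e" .
  qed
  then show ?thesis using U(1,2) by blast
qed

text \<open>An enumeration of the nonnegative rationals with repetitions: \<open>ennreal\<close>
  sends the negative ones to 0, and a level 0 contributes nothing to a supremum.\<close>

definition rational_level :: "nat \<Rightarrow> ennreal" where
  "rational_level k = ennreal (real_of_rat (from_nat k))"

lemma rational_level_dense:
  assumes "x < y"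
  shows "\<exists>k. x < rational_level k \<and> rational_level k < y"
proof -
  obtain r :: rat where r: "x < real_of_rat r" "real_of_rat r < y"
    using ennreal_rat_dense[OF assms] by blast
  show ?thesis unfolding rational_level_def
    by (rule exI[of _ "to_nat r"]) (use r in simp)
qed

text \<open>
  A family of open sets describes each superlevel set up to a null set.  Unlike Borel functions, such
  descriptions can be glued along an uncountable partition into open sets.
\<close>

lemma square_integrable_open_hull:
  fixes g :: "'a::metric_space \<Rightarrow> ennreal"
  assumes [measurable]: "g \<in> borel_measurable borel"
    and fin: "(\<integral>\<^sup>+x. (g x)\<^sup>2 \<partial>hausdorff_measure 2) < \<infinity>"
  shows "\<exists>U::nat \<Rightarrow> nat \<Rightarrow> 'a set. (\<forall>k n. open (U k n)) \<and>
    (\<forall>x. g x \<le> (SUP k. rational_level k * indicator (\<Inter>n. U k n) x)) \<and>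
    (AE x in hausdorff_measure 2. (SUP k. rational_level k * indicator (\<Inter>n. U k n) x) \<le> g x)"
proof -
  let ?q = rational_level
  let ?\<mu> = "hausdorff_measure 2 :: 'a measure"
  define L where "L k = {x. ?q k < g x}" for k
  have [measurable]: "L k \<in> sets borel" for k unfolding L_def by measurable
  \<comment> \<open>This is Chebyshev's inequality. At level 0 the superlevel set may have infinite
    measure, but there its indicator is multiplied by 0, so the whole space serves as hull.\<close>
  have Lfin: "emeasure ?\<mu> (L k) < \<infinity>" if "?q k > 0" for k
  proof -
    have q: "?q k \<noteq> 0" "?q k \<noteq> top" using that by (auto simp: rational_level_def)
    have "(?q k)\<^sup>2 * emeasure ?\<mu> (L k) = (\<integral>\<^sup>+x. (?q k)\<^sup>2 * indicator (L k) x \<partial>?\<mu>)"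
      by (simp add: nn_integral_cmult)
    also have "\<dots> \<le> (\<integral>\<^sup>+x. (g x)\<^sup>2 \<partial>?\<mu>)"
      by (intro nn_integral_mono) (auto simp: L_def indicator_def intro!: power_mono)
    also have "\<dots> < \<infinity>" by (rule fin)
    finally show ?thesis using q by (auto simp: ennreal_mult_less_top power2_eq_square)
  qed
  have "\<forall>k. \<exists>U::nat \<Rightarrow> 'a set. (\<forall>n. open (U n) \<and> L k \<subseteq> U n) \<and>
      (?q k > 0 \<longrightarrow> hausdorff_outer 2 (\<Inter>n. U n) \<le> hausdorff_outer 2 (L k))"
  proof
    fix k
    show "\<exists>U::nat \<Rightarrow> 'a set. (\<forall>n. open (U n) \<and> L k \<subseteq> U n) \<and>
        (?q k > 0 \<longrightarrow> hausdorff_outer 2 (\<Inter>n. U n) \<le> hausdorff_outer 2 (L k))"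
    proof (cases "?q k > 0")
      case True
      then have "hausdorff_outer 2 (L k) < \<infinity>" using Lfin[OF True] by (simp add: emeasure_hausdorff_measure)
      then show ?thesis using hausdorff_outer_open_hull by blast
    next
      case False
      then show ?thesis by (intro exI[of _ "\<lambda>_. UNIV"]) auto
    qed
  qed
  then have "\<exists>U :: nat \<Rightarrow> nat \<Rightarrow> 'a set. \<forall>k. (\<forall>n. open (U k n) \<and> L k \<subseteq> U k n) \<and>
      (?q k > 0 \<longrightarrow> hausdorff_outer 2 (\<Inter>n. U k n) \<le> hausdorff_outer 2 (L k))"
    by (rule choice)
  then obtain U :: "nat \<Rightarrow> nat \<Rightarrow> 'a set" where
    *: "\<forall>k. (\<forall>n. open (U k n) \<and> L k \<subseteq> U k n) \<and>
      (?q k > 0 \<longrightarrow> hausdorff_outer 2 (\<Inter>n. U k n) \<le> hausdorff_outer 2 (L k))" ..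
  have U: "open (U k n)" "L k \<subseteq> U k n"
    "?q k > 0 \<Longrightarrow> hausdorff_outer 2 (\<Inter>n. U k n) \<le> hausdorff_outer 2 (L k)" for k n
    using *[rule_format, of k] by simp_all
  have [measurable]: "(\<Inter>n. U k n) \<in> sets borel" for k using U(1) by (intro sets.countable_INT) auto
  have "g x \<le> (SUP k. ?q k * indicator (\<Inter>n. U k n) x)" for x
  proof (rule dense_le)
    fix y assume "y < g x"
    then obtain k where k: "y < ?q k" "?q k < g x" using rational_level_dense by blast
    then have "x \<in> (\<Inter>n. U k n)" using U(2)[of k] by (auto simp: L_def)
    then have "?q k \<le> (SUP k. ?q k * indicator (\<Inter>n. U k n) x)" by (intro SUP_upper2[of k]) auto
    then show "y \<le> (SUP k. ?q k * indicator (\<Inter>n. U k n) x)" using k(1) by simp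
  qed
  moreover have "AE x in ?\<mu>. (SUP k. ?q k * indicator (\<Inter>n. U k n) x) \<le> g x"
  proof -
    have "AE x in ?\<mu>. ?q k * indicator (\<Inter>n. U k n) x \<le> g x" for k
    proof (cases "?q k > 0")
      case True
      have "emeasure ?\<mu> ((\<Inter>n. U k n) - L k) = emeasure ?\<mu> (\<Inter>n. U k n) - emeasure ?\<mu> (L k)"
        using U(2)[of k] Lfin[OF True] by (intro emeasure_Diff) auto
      also have "\<dots> = 0"
        using U(3)[OF True] le_less_trans[OF U(3)[OF True]] Lfin[OF True]
        by (intro diff_eq_0_ennreal) (simp_all add: emeasure_hausdorff_measure)
      finally have "(\<Inter>n. U k n) - L k \<in> null_sets ?\<mu>" by (intro null_setsI) auto
      then show ?thesis
        by (rule AE_I') (auto simp: L_def indicator_def not_le split: if_splits)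
    qed simp
    then have "AE x in ?\<mu>. \<forall>k. ?q k * indicator (\<Inter>n. U k n) x \<le> g x" by (simp add: AE_all_countable)
    then show ?thesis by eventually_elim (auto intro: SUP_least)
  qed
  ultimately show ?thesis using U(1) by (intro exI[of _ U] conjI allI)
qed

text \<open>For fixed \<open>k\<close> and \<open>n\<close> the open sets chosen on the pieces
  combine to an open set, however many pieces there are; only countable intersections and a
  countable supremum follow, so the result is Borel. The upper bound is asserted almost everywhere
  for each piece separately, because uncountably many exceptional null sets cannot be
  combined.\<close>

lemma square_integrable_glue:
  fixes r :: "'a::metric_space \<Rightarrow> 'b" and g :: "'b \<Rightarrow> 'a \<Rightarrow> ennreal"
  assumes r: "\<And>z. open {x. r x = z}"
    and g: "\<And>z. g z \<in> borel_measurable borel" "\<And>z. (\<integral>\<^sup>+x. (g z x)\<^sup>2 \<partial>hausdorff_measure 2) < \<infinity>"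
  shows "\<exists>G\<in>borel_measurable borel. (\<forall>x. g (r x) x \<le> G x) \<and>
    (\<forall>z. AE x in hausdorff_measure 2. r x = z \<longrightarrow> G x \<le> g z x)"
proof -
  let ?h = "\<lambda>U x. SUP k. rational_level k * indicator (\<Inter>n::nat. U k n) x"
  have "\<forall>z. \<exists>U::nat \<Rightarrow> nat \<Rightarrow> 'a set. (\<forall>k n. open (U k n)) \<and> (\<forall>x. g z x \<le> ?h U x) \<and>
      (AE x in hausdorff_measure 2. ?h U x \<le> g z x)"
    by (intro allI square_integrable_open_hull[OF g])
  then have "\<exists>U. \<forall>z. (\<forall>k n. open (U z k n)) \<and> (\<forall>x. g z x \<le> ?h (U z) x) \<and>
      (AE x in hausdorff_measure 2. ?h (U z) x \<le> g z x)"
    by (rule choice)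
  then obtain U :: "'b \<Rightarrow> nat \<Rightarrow> nat \<Rightarrow> 'a set" where U: "\<And>z k n. open (U z k n)"
    "\<And>z x. g z x \<le> ?h (U z) x" "\<And>z. AE x in hausdorff_measure 2. ?h (U z) x \<le> g z x"
    by blast
  define W where "W k n = {x. x \<in> U (r x) k n}" for k n
  have "W k n = (\<Union>z. U z k n \<inter> {x. r x = z})" for k n by (auto simp: W_def)
  then have "open (W k n)" for k n using r U(1) by (simp only:) (intro open_UN ballI open_Int)
  then have [measurable]: "(\<Inter>n. W k n) \<in> sets borel" for k by (intro sets.countable_INT) auto
  define G where "G = ?h W"
  have "G \<in> borel_measurable borel" unfolding G_def by measurable
  moreover have G: "G x = ?h (U (r x)) x" for x
    unfolding G_def by (intro SUP_cong refl) (simp add: W_def indicator_def)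
  moreover have "AE x in hausdorff_measure 2. r x = z \<longrightarrow> G x \<le> g z x" for z
    using U(3)[of z] by eventually_elim (auto simp: G)
  ultimately show ?thesis using U(2) by (intro bexI[of _ G]) auto
qed

section \<open>From local to global upper gradients\<close>

text \<open>
  Choosing the neighbourhoods proportional to the radii of compact balls makes the union closed.
\<close>

lemma compact_exhaustion:
  fixes z :: "'a::metric_space"
  assumes lc: "\<And>x::'a. \<exists>e>0. compact (cball x e)"
  shows "\<exists>K::nat \<Rightarrow> 'a set. (\<forall>n. compact (K n)) \<and> (\<forall>n. K n \<subseteq> interior (K (Suc n))) \<and> z \<in> K 0 \<and>
    closed (\<Union>n. K n)"
proof -
  \<comment> \<open>The cap at 1 keeps the supremum finite when all closed balls are compact. Taking
    half of it in \<open>l\<close> stays strictly below the supremum, so that balls of radius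
    \<open>l x\<close> are compact, and makes \<open>l\<close> Lipschitz with constant 1/2.\<close>
  define S where "S x = {r. 0 < r \<and> r \<le> 1 \<and> compact (cball x r)}" for x :: 'a
  define l where "l x = Sup (S x) / 2" for x
  have down: "compact (cball y s)" if "compact (cball x r)" "cball y s \<subseteq> cball x r" for x y :: 'a and r s
    using compact_Int_closed[OF that(1) closed_cball[of y s]] that(2) by (metis inf.absorb2)
  have Sne: "S x \<noteq> {}" for x
  proof -
    obtain e where "e > 0" "compact (cball x e)" using lc by blast
    moreover have "cball x (min e 1) \<subseteq> cball x e" by auto
    ultimately have "min e 1 \<in> S x" using down[of x e x "min e 1"] by (simp add: S_def)
    then show ?thesis by blast
  qed
  have bdd: "bdd_above (S x)" for x by (rule bdd_aboveI[of _ 1]) (auto simp: S_def)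
  have pos: "l x > 0" for x
  proof -
    obtain r where r: "r \<in> S x" using Sne by blast
    then have "r \<le> Sup (S x)" by (rule cSup_upper[OF _ bdd])
    then show ?thesis using r by (auto simp: S_def l_def)
  qed
  have comp: "compact (cball x (l x))" for x
  proof -
    have "l x < Sup (S x)" using pos[of x] by (simp add: l_def)
    then obtain r where "r \<in> S x" "l x < r" using less_cSupE[OF _ Sne] by blast
    moreover from this have "cball x (l x) \<subseteq> cball x r" by auto
    ultimately show ?thesis using down[of x r x "l x"] by (simp add: S_def)
  qed
  have lip: "l x \<le> l y + dist x y / 2" for x y
  proof -
    have "Sup (S x) \<le> Sup (S y) + dist x y"
    proof (rule cSup_least[OF Sne])
      fix r assume r: "r \<in> S x"
      show "r \<le> Sup (S y) + dist x y"
      proof (cases "r \<le> dist x y")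
        case True
        then show ?thesis using pos[of y] by (simp add: l_def)
      next
        case False
        have "cball y (r - dist x y) \<subseteq> cball x r"
        proof
          fix w assume "w \<in> cball y (r - dist x y)"
          then show "w \<in> cball x r" using dist_triangle[of x w y] by simp
        qed
        then have "r - dist x y \<in> S y"
          using r False down[of x r y "r - dist x y"] by (auto simp: S_def intro: order_trans[rotated])
        then have "r - dist x y \<le> Sup (S y)" by (rule cSup_upper[OF _ bdd])
        then show ?thesis by simp
      qed
    qed
    then show ?thesis by (simp add: l_def)
  qed
  define N where "N K = {y. \<exists>x\<in>K. dist x y < l x / 2}" for K
  have ex: "\<exists>K'. compact K' \<and> N K \<subseteq> K'" if K: "compact K" for K
  proof -
    obtain D where D: "D \<subseteq> K" "finite D" "K \<subseteq> (\<Union>x\<in>D. ball x (l x / 4))"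
      by (rule compactE_image[OF K, of K "\<lambda>x. ball x (l x / 4)"]) (use pos in auto)
    have "N K \<subseteq> (\<Union>x\<in>D. cball x (l x))"
    proof
      fix y assume "y \<in> N K"
      then obtain x where x: "x \<in> K" "dist x y < l x / 2" by (auto simp: N_def)
      then obtain a where a: "a \<in> D" "dist a x < l a / 4" using D(3) by auto
      have "dist a y \<le> dist a x + dist x y" by (rule dist_triangle)
      also have "\<dots> \<le> l a" using x a lip[of x a] pos[of a] by (simp add: dist_commute)
      finally show "y \<in> (\<Union>x\<in>D. cball x (l x))" using a(1) by auto
    qed
    moreover have "compact (\<Union>x\<in>D. cball x (l x))" using D(2) comp by (intro compact_UN) auto
    ultimately show ?thesis by blast
  qed
  obtain F where F: "\<And>K. compact K \<Longrightarrow> compact (F K)" "\<And>K. compact K \<Longrightarrow> N K \<subseteq> F K"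
    using ex by metis
  define K where "K n = (F ^^ n) {z}" for n
  have K: "compact (K n)" for n by (induction n) (auto simp: K_def F(1))
  have NK: "N (K n) \<subseteq> K (Suc n)" for n using F(2)[OF K[of n]] by (simp add: K_def)
  have "K n \<subseteq> interior (K (Suc n))" for n
  proof
    fix x assume "x \<in> K n"
    then have "ball x (l x / 2) \<subseteq> N (K n)" unfolding N_def by auto
    then have "ball x (l x / 2) \<subseteq> K (Suc n)" using NK by (rule order_trans)
    then show "x \<in> interior (K (Suc n))" using pos[of x] unfolding mem_interior
      by (intro exI[of _ "l x / 2"]) simp
  qed
  moreover have "closed (\<Union>n. K n)"
    unfolding closure_subset_eq[symmetric]
  proof
    fix y assume "y \<in> closure (\<Union>n. K n)"
    then obtain n w where w: "w \<in> K n" "dist w y < l y / 4"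
      using pos[of y] unfolding closure_approachable by (metis UN_E divide_pos_pos zero_less_numeral)
    \<comment> \<open>The Lipschitz estimate gives \<open>l w \<ge> 7/8 * l y\<close>, so
      \<open>l y / 4\<close> is below \<open>l w / 2\<close>: the radius at \<open>w\<close> does
      not shrink on approach to a limit point, which is caught one step later.\<close>
    have "dist w y < l w / 2" using w(2) lip[of y w] pos[of y] by (simp add: dist_commute)
    then have "y \<in> N (K n)" using w(1) by (auto simp: N_def)
    then have "y \<in> K (Suc n)" using NK by blast
    then show "y \<in> (\<Union>n. K n)" by blast
  qed
  moreover have "z \<in> K 0" by (simp add: K_def)
  ultimately show ?thesis using K by blast
qed

text \<open>The estimate holds on short parameter intervals by continuity of the path and adds up
  over adjacent intervals, so the bisection principle \<open>Bolzano\<close> extends it to the unit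
  interval.\<close>

lemma upper_gradient_local:
  fixes v :: "'a::metric_space \<Rightarrow> real"
  assumes G: "G \<in> borel_measurable borel"
    and loc: "\<And>x. \<exists>U. open U \<and> x \<in> U \<and> (\<forall>c. path c \<longrightarrow> path_image c \<subseteq> U \<longrightarrow>
      ennreal \<bar>v (pathstart c) - v (pathfinish c)\<bar> \<le> path_nn_integral c G)"
  shows "upper_gradient v G"
  unfolding upper_gradient_def
proof (intro conjI allI impI G)
  fix c :: "real \<Rightarrow> 'a" assume "rectifiable c"
  then have c: "path c" by (simp add: rectifiable_def)
  define P where "P s t \<longleftrightarrow> (0 \<le> s \<longrightarrow> s \<le> t \<longrightarrow> t \<le> 1 \<longrightarrow> ennreal \<bar>v (c s) - v (c t)\<bar> \<le> curve_integral c {s..t} G)" for s t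
  have "P 0 1"
  proof (rule Bolzano)
    fix r s t :: real assume P: "P r s" "P s t" and le: "r \<le> s" "s \<le> t"
    show "P r t" unfolding P_def
    proof (intro impI)
      assume b: "0 \<le> r" "t \<le> 1"
      have "ennreal \<bar>v (c r) - v (c t)\<bar> \<le> ennreal (\<bar>v (c r) - v (c s)\<bar> + \<bar>v (c s) - v (c t)\<bar>)"
        by (intro ennreal_leI) linarith
      also have "\<dots> \<le> curve_integral c {r..s} G + curve_integral c {s..t} G"
        using P b le by (auto simp: P_def intro: add_mono)
      also have "\<dots> = curve_integral c {r..t} G" using b le by (intro curve_integral_Icc_combine[OF c] G)
      finally show "ennreal \<bar>v (c r) - v (c t)\<bar> \<le> curve_integral c {r..t} G" .
    qed
  next
    fix x :: real assume x: "0 \<le> x" "x \<le> 1"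
    obtain U where U: "open U" "c x \<in> U" "\<And>b. path b \<Longrightarrow> path_image b \<subseteq> U \<Longrightarrow>
        ennreal \<bar>v (pathstart b) - v (pathfinish b)\<bar> \<le> path_nn_integral b G"
      using loc by blast
    obtain e where e: "e > 0" "ball (c x) e \<subseteq> U" using U(1,2) by (auto simp: open_contains_ball)
    obtain d where d: "d > 0" "\<And>t. t \<in> {0..1} \<Longrightarrow> dist t x < d \<Longrightarrow> dist (c t) (c x) < e"
      using c x e(1) unfolding path_def continuous_on_iff by (metis atLeastAtMost_iff)
    have "P s t" if st: "s \<le> x" "x \<le> t" "t - s < d" for s t
      unfolding P_def
    proof (intro impI)
      assume b: "0 \<le> s" "t \<le> 1"
      show "ennreal \<bar>v (c s) - v (c t)\<bar> \<le> curve_integral c {s..t} G"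
      proof (cases "s = t")
        case False
        then have "s < t" using st by simp
        have "c ` {s..t} \<subseteq> U"
        proof
          fix y assume "y \<in> c ` {s..t}"
          then obtain u where u: "u \<in> {s..t}" "y = c u" by auto
          then have "dist (c u) (c x) < e" using st b by (intro d(2)) (auto simp: dist_real_def)
          then show "y \<in> U" using e(2) u(2) by (auto simp: dist_commute)
        qed
        then show ?thesis
          using U(3)[of "path_piece s t c"] \<open>s < t\<close> b path_path_piece[OF c]
          by (simp add: path_image_path_piece path_nn_integral_path_piece)
      qed simp
    qed
    then show "\<exists>d>0. \<forall>a b. a \<le> x \<and> x \<le> b \<and> b - a < d \<longrightarrow> P a b" using d(1) by blast
  qed simp
  then show "ennreal \<bar>v (pathstart c) - v (pathfinish c)\<bar> \<le> path_nn_integral c G"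
    by (simp add: P_def pathstart_def pathfinish_def path_nn_integral_eq)
qed

lemma locally_2_integrable_local:
  fixes G :: "'a::metric_space \<Rightarrow> ennreal"
  assumes [measurable]: "G \<in> borel_measurable borel"
    and loc: "\<And>x. \<exists>U. open U \<and> x \<in> U \<and> (\<integral>\<^sup>+y\<in>U. (G y)\<^sup>2 \<partial>hausdorff_measure 2) < \<infinity>"
  shows "locally_2_integrable G"
  unfolding locally_2_integrable_def
proof (intro allI impI)
  fix C :: "'a set" assume C: "compact C"
  obtain U where U: "\<And>x. open (U x)" "\<And>x. x \<in> U x" "\<And>x. (\<integral>\<^sup>+y\<in>U x. (G y)\<^sup>2 \<partial>hausdorff_measure 2) < \<infinity>"
    using loc by metis
  obtain D where D: "D \<subseteq> C" "finite D" "C \<subseteq> (\<Union>x\<in>D. U x)"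
    by (rule compactE_image[OF C, of C U]) (use U in auto)
  have [measurable]: "U x \<in> sets borel" for x using U(1) by simp
  have "(\<integral>\<^sup>+y\<in>C. (G y)\<^sup>2 \<partial>hausdorff_measure 2) \<le> (\<integral>\<^sup>+y. (\<Sum>x\<in>D. (G y)\<^sup>2 * indicator (U x) y) \<partial>hausdorff_measure 2)"
  proof (rule nn_integral_mono)
    fix y
    show "(G y)\<^sup>2 * indicator C y \<le> (\<Sum>x\<in>D. (G y)\<^sup>2 * indicator (U x) y)"
    proof (cases "y \<in> C")
      case True
      then obtain a where a: "a \<in> D" "y \<in> U a" using D(3) by auto
      have "(G y)\<^sup>2 * indicator C y = (G y)\<^sup>2 * indicator (U a) y" using True a by simp
      also have "\<dots> \<le> (\<Sum>x\<in>D. (G y)\<^sup>2 * indicator (U x) y)"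
        by (rule member_le_sum[OF a(1) _ D(2)]) simp
      finally show ?thesis .
    qed simp
  qed
  also have "\<dots> = (\<Sum>x\<in>D. \<integral>\<^sup>+y\<in>U x. (G y)\<^sup>2 \<partial>hausdorff_measure 2)"
    by (rule nn_integral_sum) measurable
  also have "\<dots> < \<infinity>" using D(2) by (induction D rule: finite_induct) (use U(3) in auto)
  finally show "(\<integral>\<^sup>+y\<in>C. (G y)\<^sup>2 \<partial>hausdorff_measure 2) < \<infinity>" .
qed

text \<open>In each component, an exhaustion by compact sets yields overlapping open shells. On the
  n-th shell the function belonging to the n-th compact set works for short paths, and the supremum
  over all shells retains this. Each point has a neighbourhood meeting only finitely many shells,
  which keeps the supremum locally square-integrable.\<close>

lemma upper_gradient_glue:
  fixes v :: "'a::metric_space \<Rightarrow> real"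
  assumes surf: "metric_surface TYPE('a)"
    and loc: "\<And>A. compact A \<Longrightarrow> \<exists>G\<in>borel_measurable borel. (\<integral>\<^sup>+x. (G x)\<^sup>2 \<partial>hausdorff_measure 2) < \<infinity> \<and>
      (\<forall>c. path c \<longrightarrow> path_image c \<subseteq> A \<longrightarrow>
        ennreal \<bar>v (pathstart c) - v (pathfinish c)\<bar> \<le> path_nn_integral c G)"
  shows "\<exists>\<rho>. upper_gradient v \<rho> \<and> locally_2_integrable \<rho>"
proof -
  let ?C = "connected_component_set (UNIV :: 'a set)"
  \<comment> \<open>The chosen representative depends only on the component, so the fibres of
    \<open>r\<close> are the components.\<close>
  define r where "r x = (SOME y. y \<in> ?C x)" for x
  have rC: "r x \<in> ?C x" for x
    unfolding r_def by (rule someI[of _ x]) simp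
  have r_eq: "r y = r x" if "y \<in> ?C x" for x y
    using connected_component_eq[OF that] by (simp add: r_def)
  have open_r: "open {x. r x = z}" for z
  proof (subst open_subopen, intro ballI)
    fix x assume "x \<in> {x. r x = z}"
    then have "?C x \<subseteq> {x. r x = z}" using r_eq by auto
    then show "\<exists>T. open T \<and> x \<in> T \<and> T \<subseteq> {x. r x = z}"
      using metric_surface_open_component[OF surf, of x] by (intro exI[of _ "?C x"]) auto
  qed
  have "\<exists>K::nat \<Rightarrow> 'a set. (\<forall>n. compact (K n)) \<and> (\<forall>n. K n \<subseteq> interior (K (Suc n))) \<and> z \<in> K 0 \<and>
      closed (\<Union>n. K n)" for z
    by (rule compact_exhaustion[OF metric_surface_locally_compact[OF surf]])
  then obtain K :: "'a \<Rightarrow> nat \<Rightarrow> 'a set" where K: "\<And>z n. compact (K z n)"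
    "\<And>z n. K z n \<subseteq> interior (K z (Suc n))" "\<And>z. z \<in> K z 0" "\<And>z. closed (\<Union>n. K z n)"
    by metis
  have "K z n \<subseteq> K z (Suc n)" for z n using K(2) interior_subset by (rule order_trans)
  then have Kmono: "K z n \<subseteq> K z m" if "n \<le> m" for z n m
    using that by (rule lift_Suc_mono_le)
  have cover: "x \<in> (\<Union>n. K (r x) n)" for x
  proof -
    let ?U = "\<Union>n. K (r x) n"
    \<comment> \<open>The union is open by the nesting into interiors and closed by construction, so
      it contains the whole component that it meets. It may also reach into other components, hence
      the later restriction to a fibre of \<open>r\<close>.\<close>
    have eq: "?U = (\<Union>n. interior (K (r x) n))"
    proof
      show "?U \<subseteq> (\<Union>n. interior (K (r x) n))" using K(2) by (intro UN_least) blast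
      show "(\<Union>n. interior (K (r x) n)) \<subseteq> ?U" using interior_subset by (intro UN_mono) auto
    qed
    have "open ?U" unfolding eq by (intro open_UN ballI open_interior)
    moreover have "open (- ?U)" using K(4)[of "r x"] by (rule open_Compl)
    ultimately have "?U \<inter> ?C x = {} \<or> - ?U \<inter> ?C x = {}"
      by (intro connectedD[OF connected_connected_component]) auto
    moreover have "r x \<in> ?U" using K(3) by blast
    ultimately have "- ?U \<inter> ?C x = {}" using rC[of x] by blast
    moreover have "x \<in> ?C x" by simp
    ultimately show ?thesis by blast
  qed
  define P where "P A h \<longleftrightarrow> h \<in> borel_measurable borel \<and> (\<integral>\<^sup>+x. (h x)\<^sup>2 \<partial>hausdorff_measure 2) < \<infinity> \<and>
      (\<forall>c. path c \<longrightarrow> path_image c \<subseteq> A \<longrightarrow>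
        ennreal \<bar>v (pathstart c) - v (pathfinish c)\<bar> \<le> path_nn_integral c h)" for A h
  have ex: "\<exists>h. P (K z n) h" for z n using loc[OF K(1)[of z n]] unfolding P_def by blast
  define g where "g n z = (SOME h. P (K z n) h)" for n z
  have "P (K z n) (g n z)" for n z unfolding g_def by (rule someI_ex[OF ex])
  then have g: "g n z \<in> borel_measurable borel" "(\<integral>\<^sup>+x. (g n z x)\<^sup>2 \<partial>hausdorff_measure 2) < \<infinity>"
    "path c \<Longrightarrow> path_image c \<subseteq> K z n \<Longrightarrow>
      ennreal \<bar>v (pathstart c) - v (pathfinish c)\<bar> \<le> path_nn_integral c (g n z)" for n z c
    unfolding P_def by blast+
  define R where "R n H \<longleftrightarrow> H \<in> borel_measurable borel \<and> (\<forall>x. g n (r x) x \<le> H x) \<and>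
      (\<forall>z. AE x in hausdorff_measure 2. r x = z \<longrightarrow> H x \<le> g n z x)" for n H
  have ex: "\<exists>H. R n H" for n
  proof -
    have "\<exists>H\<in>borel_measurable borel. (\<forall>x. g n (r x) x \<le> H x) \<and>
        (\<forall>z. AE x in hausdorff_measure 2. r x = z \<longrightarrow> H x \<le> g n z x)"
      by (rule square_integrable_glue[OF open_r g(1,2)])
    then show ?thesis unfolding R_def by blast
  qed
  define G where "G n = (SOME H. R n H)" for n
  have "R n (G n)" for n unfolding G_def by (rule someI_ex[OF ex])
  then have [measurable]: "G n \<in> borel_measurable borel"
    and G: "g n (r x) x \<le> G n x" "AE x in hausdorff_measure 2. r x = z \<longrightarrow> G n x \<le> g n z x" for n x z
    unfolding R_def by blast+
  \<comment> \<open>Removing only \<open>K z (n - 2)\<close> makes the open shells overlap, so they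
    still cover: for the least \<open>n\<close> with a given point in the interior of
    \<open>K z n\<close>, the point is not in \<open>K z (n - 2)\<close>, which lies in the interior
    of \<open>K z (n - 1)\<close>. The case distinction prevents truncated subtraction from removing
    \<open>K z 0\<close> for \<open>n < 2\<close>.\<close>
  define Q where "Q z n = interior (K z n) - (if n < 2 then {} else K z (n - 2))" for z n
  have open_Q: "open (Q z n)" for z n
    using K(1) unfolding Q_def by (auto intro!: open_Diff compact_imp_closed)
  have cover_Q: "\<exists>n. x \<in> Q (r x) n" for x
  proof -
    have ex: "\<exists>n. x \<in> interior (K (r x) n)" using cover[of x] K(2) by blast
    define n where "n = (LEAST n. x \<in> interior (K (r x) n))"
    have "x \<in> interior (K (r x) n)" unfolding n_def by (rule LeastI_ex[OF ex])
    moreover have "x \<notin> K (r x) (n - 2)" if "\<not> n < 2"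
    proof
      assume "x \<in> K (r x) (n - 2)"
      then have "x \<in> interior (K (r x) (Suc (n - 2)))" using K(2) by blast
      then have "n \<le> Suc (n - 2)" unfolding n_def by (rule Least_le)
      then show False using that by simp
    qed
    ultimately show ?thesis by (auto simp: Q_def)
  qed
  define B where "B n = {x. x \<in> Q (r x) n}" for n
  have "B n = (\<Union>z. Q z n \<inter> {x. r x = z})" for n by (auto simp: B_def)
  then have "open (B n)" for n using open_r open_Q by (simp only:) (intro open_UN ballI open_Int)
  then have [measurable]: "B n \<in> sets borel" for n by simp
  define \<rho> where "\<rho> x = (SUP n. G n x * indicator (B n) x)" for x
  have \<rho>_meas [measurable]: "\<rho> \<in> borel_measurable borel" unfolding \<rho>_def by measurable
  have "upper_gradient v \<rho>"
  proof (rule upper_gradient_local[OF \<rho>_meas])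
    fix x
    obtain n where n: "x \<in> Q (r x) n" using cover_Q by blast
    let ?U = "Q (r x) n \<inter> {y. r y = r x}"
    have "ennreal \<bar>v (pathstart c) - v (pathfinish c)\<bar> \<le> path_nn_integral c \<rho>"
      if c: "path c" "path_image c \<subseteq> ?U" for c
    proof -
      have "path_image c \<subseteq> K (r x) n" using c(2) interior_subset by (auto simp: Q_def)
      then have "ennreal \<bar>v (pathstart c) - v (pathfinish c)\<bar> \<le> path_nn_integral c (g n (r x))"
        by (rule g(3)[OF c(1)])
      also have "\<dots> \<le> path_nn_integral c \<rho>"
        unfolding path_nn_integral_eq
      proof (rule curve_integral_mono)
        fix y assume "y \<in> c ` {0..1}"
        then have y: "y \<in> Q (r x) n" "r y = r x" using c(2) by (auto simp: path_image_def)
        have "g n (r x) y \<le> G n y * indicator (B n) y" using G(1)[where n=n and x=y] y by (simp add: B_def)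
        also have "\<dots> \<le> \<rho> y" unfolding \<rho>_def by (rule SUP_upper) simp
        finally show "g n (r x) y \<le> \<rho> y" .
      qed
      finally show ?thesis .
    qed
    moreover have "open ?U" by (intro open_Int open_Q open_r)
    ultimately show "\<exists>U. open U \<and> x \<in> U \<and> (\<forall>c. path c \<longrightarrow> path_image c \<subseteq> U \<longrightarrow>
        ennreal \<bar>v (pathstart c) - v (pathfinish c)\<bar> \<le> path_nn_integral c \<rho>)"
      using n by (intro exI[of _ ?U]) auto
  qed
  moreover have "locally_2_integrable \<rho>"
  proof (rule locally_2_integrable_local[OF \<rho>_meas])
    fix x
    obtain m where m: "x \<in> interior (K (r x) m)" using cover[of x] K(2) by blast
    let ?U = "interior (K (r x) m) \<inter> {y. r y = r x}"
    have U: "open ?U" by (intro open_Int open_interior open_r)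
    have [measurable]: "?U \<in> sets borel" using U by simp
    have bound: "\<rho> y \<le> (\<Sum>n<m+2. G n y)" if y: "y \<in> ?U" for y
      unfolding \<rho>_def
    proof (rule SUP_least)
      fix n
      show "G n y * indicator (B n) y \<le> (\<Sum>n<m+2. G n y)"
      proof (cases "y \<in> B n")
        case True
        have "n < m + 2"
        proof (rule ccontr)
          assume "\<not> n < m + 2"
          then have "K (r x) m \<subseteq> K (r x) (n - 2)" by (intro Kmono) simp
          then show False using True y \<open>\<not> n < m + 2\<close> interior_subset[of "K (r x) m"]
            by (auto simp: B_def Q_def)
        qed
        have "G n y * indicator (B n) y = G n y" using True by simp
        also have "\<dots> \<le> (\<Sum>n<m+2. G n y)" by (rule member_le_sum) (use \<open>n < m + 2\<close> in auto)
        finally show ?thesis .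
      qed simp
    qed
    \<comment> \<open>Since \<open>?U\<close> lies in a single component, the almost everywhere
      bound for that one fibre of \<open>r\<close> is enough.\<close>
    have Gfin: "(\<integral>\<^sup>+y\<in>?U. (G n y)\<^sup>2 \<partial>hausdorff_measure 2) < \<infinity>" for n
    proof -
      have "AE y in hausdorff_measure 2. (G n y)\<^sup>2 * indicator ?U y \<le> (g n (r x) y)\<^sup>2"
        using G(2)[where n=n and z="r x"] by eventually_elim (auto simp: indicator_def intro: power_mono)
      then have "(\<integral>\<^sup>+y\<in>?U. (G n y)\<^sup>2 \<partial>hausdorff_measure 2) \<le> (\<integral>\<^sup>+y. (g n (r x) y)\<^sup>2 \<partial>hausdorff_measure 2)"
        by (rule nn_integral_mono_AE)
      also have "\<dots> < \<infinity>" by (rule g(2))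
      finally show ?thesis .
    qed
    have "(\<integral>\<^sup>+y\<in>?U. (\<rho> y)\<^sup>2 \<partial>hausdorff_measure 2)
        \<le> (\<integral>\<^sup>+y. (\<Sum>n<m+2. 2 ^ (n + 1) * ((G n y)\<^sup>2 * indicator ?U y)) \<partial>hausdorff_measure 2)"
    proof (rule nn_integral_mono)
      fix y
      show "(\<rho> y)\<^sup>2 * indicator ?U y \<le> (\<Sum>n<m+2. 2 ^ (n + 1) * ((G n y)\<^sup>2 * indicator ?U y))"
      proof (cases "y \<in> ?U")
        case True
        have "(\<rho> y)\<^sup>2 \<le> (\<Sum>n<m+2. G n y)\<^sup>2" by (rule power_mono[OF bound[OF True]]) simp
        also have "\<dots> \<le> (\<Sum>n<m+2. 2 ^ (n + 1) * (G n y)\<^sup>2)" by (rule ennreal_sum_power2_le)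
        finally show ?thesis using True by simp
      qed simp
    qed
    also have "\<dots> < \<infinity>"
    proof -
      have "(\<integral>\<^sup>+y. (\<Sum>n<k. 2 ^ (n + 1) * ((G n y)\<^sup>2 * indicator ?U y)) \<partial>hausdorff_measure 2)
          = (\<Sum>n<k. 2 ^ (n + 1) * (\<integral>\<^sup>+y\<in>?U. (G n y)\<^sup>2 \<partial>hausdorff_measure 2))" for k
        by (simp add: nn_integral_sum nn_integral_cmult)
      moreover have "(\<Sum>n<k. 2 ^ (n + 1) * (\<integral>\<^sup>+y\<in>?U. (G n y)\<^sup>2 \<partial>hausdorff_measure 2)) < \<infinity>" for k
        by (induction k) (use Gfin in \<open>auto simp: ennreal_mult_less_top power_less_top_ennreal\<close>)
      ultimately show ?thesis by (simp only:)
    qed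
    finally show "\<exists>U. open U \<and> x \<in> U \<and> (\<integral>\<^sup>+y\<in>U. (\<rho> y)\<^sup>2 \<partial>hausdorff_measure 2) < \<infinity>"
      using U m by (intro exI[of _ ?U]) auto
  qed
  ultimately show ?thesis by blast
qed

theorem theorem1p5:
  fixes f :: "'y::metric_space \<Rightarrow> 'x::metric_space" and u :: "'x \<Rightarrow> real"
  assumes "metric_surface TYPE('y)"
    and "metric_surface TYPE('x)"
    and "weakly_quasiconformal f"
    and "weakly_monotone u"
    and "\<exists>\<rho>. upper_gradient u \<rho> \<and> locally_2_integrable \<rho>"
  shows "weakly_monotone (u \<circ> f) \<and>
    (\<exists>\<rho>. upper_gradient (u \<circ> f) \<rho> \<and> locally_2_integrable \<rho>)"
proof
  obtain K h where K: "K \<ge> 1" and h: "\<And>n::nat. \<exists>g. homeomorphism UNIV UNIV (h n) g"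
    and lim: "uniform_limit UNIV h f sequentially"
    and qc: "\<forall>\<Gamma>. (\<forall>\<gamma>\<in>\<Gamma>. path \<gamma>) \<longrightarrow> modulus2 \<Gamma> \<le> ennreal K * modulus2 ((\<lambda>\<gamma>. f \<circ> \<gamma>) ` \<Gamma>)"
    using assms(3) unfolding weakly_quasiconformal_def weakly_K_quasiconformal_def by blast
  obtain \<rho> where \<rho>: "upper_gradient u \<rho>" "locally_2_integrable \<rho>" using assms(5) by blast
  have contf: "continuous_on UNIV f" by (rule uniform_limit_homeomorphisms_continuous[OF h lim])
  have fin: "emeasure (hausdorff_measure 2) C < \<infinity>" if "compact C" for C :: "'x set"
    using assms(2) that by (simp add: metric_surface_def)
  show "weakly_monotone (u \<circ> f)" by (rule weakly_monotone_comp[OF assms(2) h lim assms(4)])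
  show "\<exists>\<rho>. upper_gradient (u \<circ> f) \<rho> \<and> locally_2_integrable \<rho>"
  proof (rule upper_gradient_glue[OF assms(1)])
    fix A :: "'y set" assume "compact A"
    then show "\<exists>G\<in>borel_measurable borel. (\<integral>\<^sup>+x. (G x)\<^sup>2 \<partial>hausdorff_measure 2) < \<infinity> \<and>
        (\<forall>c. path c \<longrightarrow> path_image c \<subseteq> A \<longrightarrow>
          ennreal \<bar>(u \<circ> f) (pathstart c) - (u \<circ> f) (pathfinish c)\<bar> \<le> path_nn_integral c G)"
      using upper_gradient_comp_on_compact[OF _ qc contf fin \<rho>] K by simp
  qed
qed

end
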